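(* For every finite undirected bipartite graph $G$ and every prime power $q$, $$\mathbb{CAP}_q(G)=M(G),$$ where $M(G)$ is the maximum size of a matching in $G$; moreover, an RDSS code for $G$ of this dimension can be designed in polynomial time.
   Context: Let $G$ have vertex set $V=\{1,\dots,n\}$ and, for $i\in V$, let $N(i)$ be the set of neighbours of $i$. For $X\in\mathbb{F}_q^n$ and $I\subseteq V$, $X_I\in\mathbb{F}_q^{|I|}$ denotes the projection onto the coordinates in $I$. An RDSS (recoverable distributed storage system) code for $G$ is a set $\mathcal{C}\subseteq\mathbb{F}_q^n$ for which there are deterministic functions $f_i:\mathbb{F}_q^{|N(i)|}\to\mathbb{F}_q$, $i=1,\dots,n$, with $X_i=f_i(X_{N(i)})$ for all $X\in\mathcal{C}$ and all $i$. Its dimension is $\log_q|\mathcal{C}|$. $\mathbb{CAP}_q(G)$ denotes the maximum dimension of an RDSS code over $\mathbb{F}_q$ for $G$. Polynomial time is with respect to the size of $G$; designing a code means producing a description of its encoding map (from message symbols to the content of each vertex) and its recovery functions. *)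

theory Defs
  imports
    Complex_Main
    "HOL-Library.FuncSet"
    "HOL-Library.Disjoint_Sets"
    "HOL-Computational_Algebra.Polynomial"
    "HOL-Number_Theory.Prime_Powers"
    "HOL-Algebra.Ring"
    "HOL-Algebra.Coset"
begin

section \<open>Bipartite graphs and matchings\<close>

record ugraph =
  nverts :: nat
  edges :: "nat set set"

definition verts :: "ugraph \<Rightarrow> nat set" where
  "verts G = {1..nverts G}"

definition simple_graph :: "ugraph \<Rightarrow> bool" where
  "simple_graph G \<longleftrightarrow> (\<forall>e\<in>edges G. e \<subseteq> verts G \<and> card e = 2)"

definition bipartite :: "ugraph \<Rightarrow> bool" where
  "bipartite G \<longleftrightarrow>
     (\<exists>A B. A \<union> B = verts G \<and> A \<inter> B = {} \<and> (\<forall>e\<in>edges G. \<exists>a\<in>A. \<exists>b\<in>B. e = {a, b}))"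

definition nbrs :: "ugraph \<Rightarrow> nat \<Rightarrow> nat set" where
  "nbrs G i = {j \<in> verts G. {i, j} \<in> edges G}"

definition matching :: "ugraph \<Rightarrow> nat set set \<Rightarrow> bool" where
  "matching G M \<longleftrightarrow> M \<subseteq> edges G \<and> disjoint M"

definition matching_number :: "ugraph \<Rightarrow> nat" where
  "matching_number G = Max {card M |M. matching G M}"

definition graph_size :: "ugraph \<Rightarrow> nat" where
  "graph_size G = nverts G + card (edges G)"

section \<open>RDSS codes over a finite field\<close>

definition is_Fq :: "nat \<Rightarrow> ('f, 'm) ring_scheme \<Rightarrow> bool" where
  "is_Fq q F \<longleftrightarrow> field F \<and> finite (carrier F) \<and> order F = q"

text \<open>\<open>I \<rightarrow>\<^sub>E carrier F\<close> is the set of vectors over \<open>F\<close> with coordinates indexed by \<open>I\<close>, and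
  \<open>restrict X I\<close> is the projection of \<open>X\<close> onto the coordinates in \<open>I\<close>.\<close>

definition recovers :: "('f, 'm) ring_scheme \<Rightarrow> ugraph \<Rightarrow> (nat \<Rightarrow> (nat \<Rightarrow> 'f) \<Rightarrow> 'f)
    \<Rightarrow> (nat \<Rightarrow> 'f) set \<Rightarrow> bool" where
  "recovers F G f C \<longleftrightarrow>
     (\<forall>i\<in>verts G. f i \<in> (nbrs G i \<rightarrow>\<^sub>E carrier F) \<rightarrow> carrier F \<and>
                  (\<forall>X\<in>C. X i = f i (restrict X (nbrs G i))))"

definition rdss_code :: "('f, 'm) ring_scheme \<Rightarrow> ugraph \<Rightarrow> (nat \<Rightarrow> 'f) set \<Rightarrow> bool" where
  "rdss_code F G C \<longleftrightarrow> C \<subseteq> verts G \<rightarrow>\<^sub>E carrier F \<and> (\<exists>f. recovers F G f C)"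

definition code_dim :: "('f, 'm) ring_scheme \<Rightarrow> (nat \<Rightarrow> 'f) set \<Rightarrow> real" where
  "code_dim F C = log (real (order F)) (real (card C))"

text \<open>The empty code is left out of the maximum: its dimension would be minus infinity, whereas
  \<^term>\<open>log b 0 = 0\<close>.\<close>

definition CAP :: "('f, 'm) ring_scheme \<Rightarrow> ugraph \<Rightarrow> real" where
  "CAP F G = Max {code_dim F C |C. rdss_code F G C \<and> C \<noteq> {}}"

section \<open>Descriptions of codes\<close>

text \<open>Maps from vectors over \<open>F\<close> to \<open>F\<close> are described by arithmetic expressions in the coordinates.
  The constants are those of the prime field, so that a description presupposes no numbering of the
  elements of \<open>F\<close>.\<close>

datatype fexp = FZero | FOne | FVar nat | FAdd fexp fexp | FMul fexp fexp

primrec feval :: "('f, 'm) ring_scheme \<Rightarrow> (nat \<Rightarrow> 'f) \<Rightarrow> fexp \<Rightarrow> 'f" where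
  "feval F x FZero = \<zero>\<^bsub>F\<^esub>"
| "feval F x FOne = \<one>\<^bsub>F\<^esub>"
| "feval F x (FVar j) = x j"
| "feval F x (FAdd a b) = feval F x a \<oplus>\<^bsub>F\<^esub> feval F x b"
| "feval F x (FMul a b) = feval F x a \<otimes>\<^bsub>F\<^esub> feval F x b"

primrec fvars :: "fexp \<Rightarrow> nat set" where
  "fvars FZero = {}"
| "fvars FOne = {}"
| "fvars (FVar j) = {j}"
| "fvars (FAdd a b) = fvars a \<union> fvars b"
| "fvars (FMul a b) = fvars a \<union> fvars b"

text \<open>Expression \<open>enc i\<close> gives the content of vertex \<open>i\<close> in terms of the message symbols
  \<open>1, \<dots>, msg_len\<close>; expression \<open>recov i\<close> gives the content of vertex \<open>i\<close> in terms of the contents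
  of its neighbours.\<close>

record code_desc =
  msg_len :: nat
  enc :: "nat \<Rightarrow> fexp"
  recov :: "nat \<Rightarrow> fexp"

definition messages :: "('f, 'm) ring_scheme \<Rightarrow> code_desc \<Rightarrow> (nat \<Rightarrow> 'f) set" where
  "messages F D = {1..msg_len D} \<rightarrow>\<^sub>E carrier F"

definition encode :: "('f, 'm) ring_scheme \<Rightarrow> ugraph \<Rightarrow> code_desc \<Rightarrow> (nat \<Rightarrow> 'f) \<Rightarrow> nat \<Rightarrow> 'f" where
  "encode F G D w = (\<lambda>i\<in>verts G. feval F w (enc D i))"

definition described_code :: "('f, 'm) ring_scheme \<Rightarrow> ugraph \<Rightarrow> code_desc \<Rightarrow> (nat \<Rightarrow> 'f) set" where
  "described_code F G D = encode F G D ` messages F D"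

definition describes_rdss_code :: "('f, 'm) ring_scheme \<Rightarrow> ugraph \<Rightarrow> code_desc \<Rightarrow> bool" where
  "describes_rdss_code F G D \<longleftrightarrow>
     (\<forall>i\<in>verts G. fvars (enc D i) \<subseteq> {1..msg_len D} \<and> fvars (recov D i) \<subseteq> nbrs G i) \<and>
     inj_on (encode F G D) (messages F D) \<and>
     rdss_code F G (described_code F G D) \<and>
     recovers F G (\<lambda>i Y. feval F Y (recov D i)) (described_code F G D)"

text \<open>Descriptions are written out in prefix notation, which is uniquely decodable.\<close>

primrec tokens :: "fexp \<Rightarrow> nat list" where
  "tokens FZero = [1]"
| "tokens FOne = [2]"
| "tokens (FVar j) = [3, j]"
| "tokens (FAdd a b) = 4 # tokens a @ tokens b"
| "tokens (FMul a b) = 5 # tokens a @ tokens b"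

definition desc_tokens :: "ugraph \<Rightarrow> code_desc \<Rightarrow> nat list" where
  "desc_tokens G D = msg_len D #
     concat (map (\<lambda>i. tokens (enc D i)) [1..<Suc (nverts G)]) @
     concat (map (\<lambda>i. tokens (recov D i)) [1..<Suc (nverts G)])"

section \<open>The machine model\<close>

text \<open>A random access machine with structured control flow and finitely many named, unbounded arrays
  of natural numbers. Time is unit cost per operation. There is no multiplication, hence in \<open>t\<close> steps
  numbers grow by \<open>O(t)\<close> bits only and polynomial time agrees with that of Turing machines.\<close>

datatype aexp =
    Num nat
  | Cell string aexp
  | Add aexp aexp
  | Sub aexp aexp

datatype bexp =
    Less aexp aexp
  | BNot bexp
  | BAnd bexp bexp

datatype com =
    Skip
  | Assign string aexp aexp
  | Seq com com
  | If bexp com com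
  | While bexp com

type_synonym state = "string \<Rightarrow> nat \<Rightarrow> nat"

primrec aval :: "aexp \<Rightarrow> state \<Rightarrow> nat" where
  "aval (Num k) s = k"
| "aval (Cell x a) s = s x (aval a s)"
| "aval (Add a b) s = aval a s + aval b s"
| "aval (Sub a b) s = aval a s - aval b s"

primrec bval :: "bexp \<Rightarrow> state \<Rightarrow> bool" where
  "bval (Less a b) s \<longleftrightarrow> aval a s < aval b s"
| "bval (BNot b) s \<longleftrightarrow> \<not> bval b s"
| "bval (BAnd b c) s \<longleftrightarrow> bval b s \<and> bval c s"

primrec acost :: "aexp \<Rightarrow> nat" where
  "acost (Num k) = 1"
| "acost (Cell x a) = 1 + acost a"
| "acost (Add a b) = 1 + acost a + acost b"
| "acost (Sub a b) = 1 + acost a + acost b"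

primrec bcost :: "bexp \<Rightarrow> nat" where
  "bcost (Less a b) = 1 + acost a + acost b"
| "bcost (BNot b) = 1 + bcost b"
| "bcost (BAnd b c) = 1 + bcost b + bcost c"

text \<open>\<open>runs c s t s'\<close>: started in state \<open>s\<close>, program \<open>c\<close> halts in state \<open>s'\<close> after time \<open>t\<close>.\<close>

inductive runs :: "com \<Rightarrow> state \<Rightarrow> nat \<Rightarrow> state \<Rightarrow> bool" where
  Skip: "runs Skip s 1 s"
| Assign: "runs (Assign x a b) s (1 + acost a + acost b) (s(x := (s x)(aval a s := aval b s)))"
| Seq: "runs c\<^sub>1 s t\<^sub>1 s' \<Longrightarrow> runs c\<^sub>2 s' t\<^sub>2 s'' \<Longrightarrow> runs (Seq c\<^sub>1 c\<^sub>2) s (t\<^sub>1 + t\<^sub>2) s''"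
| IfTrue: "bval b s \<Longrightarrow> runs c\<^sub>1 s t s' \<Longrightarrow> runs (If b c\<^sub>1 c\<^sub>2) s (1 + bcost b + t) s'"
| IfFalse: "\<not> bval b s \<Longrightarrow> runs c\<^sub>2 s t s' \<Longrightarrow> runs (If b c\<^sub>1 c\<^sub>2) s (1 + bcost b + t) s'"
| WhileFalse: "\<not> bval b s \<Longrightarrow> runs (While b c) s (1 + bcost b) s"
| WhileTrue: "bval b s \<Longrightarrow> runs c s t s' \<Longrightarrow> runs (While b c) s' t' s'' \<Longrightarrow>
    runs (While b c) s (1 + bcost b + t + t') s''"

text \<open>A graph is given to a program by its number of vertices and an arbitrary list of its edges,
  each edge as a pair of endpoints in either order. Scalars are kept in cell 0 of an array.\<close>

definition edge_list :: "ugraph \<Rightarrow> (nat \<times> nat) list \<Rightarrow> bool" where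
  "edge_list G es \<longleftrightarrow>
     distinct (map (\<lambda>(u, v). {u, v}) es) \<and> set (map (\<lambda>(u, v). {u, v}) es) = edges G"

definition scalar :: "nat \<Rightarrow> nat \<Rightarrow> nat" where
  "scalar k i = (if i = 0 then k else 0)"

definition array_of :: "nat list \<Rightarrow> nat \<Rightarrow> nat" where
  "array_of xs i = (if i < length xs then xs ! i else 0)"

definition input_state :: "nat \<Rightarrow> ugraph \<Rightarrow> (nat \<times> nat) list \<Rightarrow> state" where
  "input_state q G es = (\<lambda>x i. 0)
     (''q'' := scalar q,
      ''n'' := scalar (nverts G),
      ''m'' := scalar (length es),
      ''u'' := array_of (map fst es),
      ''v'' := array_of (map snd es))"

definition outputs :: "state \<Rightarrow> nat list \<Rightarrow> bool" where
  "outputs s xs \<longleftrightarrow> s ''outlen'' 0 = length xs \<and> (\<forall>i<length xs. s ''out'' i = xs ! i)"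

end

(* A vertex outside a vertex cover is recovered from coordinates in the cover, so a cover of size k
   bounds the dimension by k, while a matching of size k gives a code of dimension k by storing one
   message symbol at both ends of each matching edge. Both of them come from one auction: left
   vertices buy a cheapest neighbour, displacing its owner and raising its price by one, until they
   are matched or all their neighbours cost more than the number of vertices. Some price level is then
   unused, and cutting the matching there yields a vertex cover of the same size, as in Koenig's
   theorem. Prices are bounded, so the auction takes polynomial time. *)
theory Submission
  imports Defs
begin

section \<open>Total correctness with time bounds\<close>

text \<open>The program receives an edge list but no bipartition, and the auction has to know which
  vertices bid. So a two-colouring is computed first; a given bipartition occurs only in the proof,
  as a yardstick for the colours. Prices play the part of dual variables: \<open>slack\<close> says
  that the vertex held by a bidder costs at most one more than any neighbour of that bidder, which
  is approximate complementary slackness for unit increments. The cap is \<open>L = n + 1\<close>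
  because \<open>n\<close> vertices cannot occupy all levels from \<open>1\<close> to
  \<open>n + 1\<close>. The matching and the cover of equal size certify three things at once: the
  matching number, the capacity and the output of the program. Hence even the capacity formula,
  which speaks of no machine, is read off a terminating run. The code merely copies message symbols
  or stores zero, so one description serves every field.\<close>

definition wp :: "com \<Rightarrow> nat \<Rightarrow> (state \<Rightarrow> bool) \<Rightarrow> state \<Rightarrow> bool" where
  "wp c T Q s \<longleftrightarrow> (\<exists>t s'. runs c s t s' \<and> t \<le> T \<and> Q s')"

primrec loopfree :: "com \<Rightarrow> bool" where
  "loopfree Skip = True"
| "loopfree (Assign x a b) = True"
| "loopfree (Seq c d) = (loopfree c \<and> loopfree d)"
| "loopfree (If b c d) = (loopfree c \<and> loopfree d)"
| "loopfree (While b c) = False"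

text \<open>Loop-free code is run symbolically, so that the simplifier computes its effect. The
  \<open>While\<close> equations here and in \<open>max_cost\<close> are fillers: both functions are
  applied to loop-free code.\<close>

primrec exec :: "com \<Rightarrow> state \<Rightarrow> state" where
  "exec Skip s = s"
| "exec (Assign x a b) s = s(x := (s x)(aval a s := aval b s))"
| "exec (Seq c d) s = exec d (exec c s)"
| "exec (If b c d) s = (if bval b s then exec c s else exec d s)"
| "exec (While b c) s = s"

primrec max_cost :: "com \<Rightarrow> nat" where
  "max_cost Skip = 1"
| "max_cost (Assign x a b) = 1 + acost a + acost b"
| "max_cost (Seq c d) = max_cost c + max_cost d"
| "max_cost (If b c d) = 1 + bcost b + max (max_cost c) (max_cost d)"
| "max_cost (While b c) = 0"

primrec writes :: "com \<Rightarrow> string set" where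
  "writes Skip = {}"
| "writes (Assign x a b) = {x}"
| "writes (Seq c d) = writes c \<union> writes d"
| "writes (If b c d) = writes c \<union> writes d"
| "writes (While b c) = writes c"

lemma runs_exec: "loopfree c \<Longrightarrow> \<exists>t. runs c s t (exec c s) \<and> t \<le> max_cost c"
proof (induction c arbitrary: s)
  case Skip
  then show ?case by (auto intro: runs.Skip)
next
  case (Assign x a b)
  show ?case using runs.Assign[of x a b s]
    by (intro exI[of _ "1 + acost a + acost b"]) (simp add: fun_upd_def)
next
  case (Seq c d)
  then obtain t1 t2 where
    "runs c s t1 (exec c s)" "t1 \<le> max_cost c"
    "runs d (exec c s) t2 (exec d (exec c s))" "t2 \<le> max_cost d"
    by (metis loopfree.simps(3))
  then show ?case by (auto intro!: exI[of _ "t1 + t2"] runs.Seq)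
next
  case (If b c d)
  show ?case
  proof (cases "bval b s")
    case True
    obtain t where "runs c s t (exec c s)" "t \<le> max_cost c"
      using If by fastforce
    with True show ?thesis by (auto intro!: exI[of _ "1 + bcost b + t"] runs.IfTrue[simplified])
  next
    case False
    obtain t where "runs d s t (exec d s)" "t \<le> max_cost d"
      using If by fastforce
    with False show ?thesis by (auto intro!: exI[of _ "1 + bcost b + t"] runs.IfFalse[simplified])
  qed
qed simp

lemma runs_unwritten: "runs c s t s' \<Longrightarrow> y \<notin> writes c \<Longrightarrow> s' y = s y"
  by (induction rule: runs.induct) auto

lemma wp_exec: "loopfree c \<Longrightarrow> Q (exec c s) \<Longrightarrow> max_cost c \<le> T \<Longrightarrow> wp c T Q s"
  unfolding wp_def using runs_exec[of c s] by (meson order_trans)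

lemma wp_Seq: "wp c T1 (wp d T2 Q) s \<Longrightarrow> T1 + T2 \<le> T \<Longrightarrow> wp (Seq c d) T Q s"
  unfolding wp_def by (meson add_mono order_trans runs.Seq)

lemma wp_mono: "wp c T Q s \<Longrightarrow> (\<And>s'. Q s' \<Longrightarrow> R s') \<Longrightarrow> wp c T R s"
  unfolding wp_def by meson

text \<open>The frame condition enters here: arrays are kept whole and by name, and
  \<open>writes\<close> over-approximates what a program changes.\<close>

lemma wp_conseq: 
  assumes "wp c T Q s" and "T \<le> T'"
    and "\<And>s'. Q s' \<Longrightarrow> (\<And>y. y \<notin> writes c \<Longrightarrow> s' y = s y) \<Longrightarrow> R s'"
  shows "wp c T' R s"
  using assms unfolding wp_def by (meson order_trans runs_unwritten)

text \<open>The variant drops in every iteration, so there are fewer than \<open>k\<close> of them,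
  and the remaining charge of \<open>R\<close> pays for the last, failing test. At
  \<open>k = 0\<close> the bound on the variant is contradictory.\<close>

lemma wp_While:
  assumes init: "I s"
    and body: "\<And>s. I s \<Longrightarrow> bval b s \<Longrightarrow> wp c T (\<lambda>s'. I s' \<and> \<mu> s' < \<mu> s) s"
    and bound: "\<mu> s < k" and time: "T + 1 + bcost b \<le> R"
  shows "wp (While b c) (k * R) (\<lambda>s. I s \<and> \<not> bval b s) s"
  using init bound
proof (induction k arbitrary: s)
  case (Suc k)
  show ?case
  proof (cases "bval b s")
    case False
    then have "runs (While b c) s (1 + bcost b) s" by (rule runs.WhileFalse)
    with False Suc.prems time show ?thesis unfolding wp_def
      by (intro exI[of _ "1 + bcost b"] exI[of _ s]) auto
  next
    case True
    obtain t s' where 1: "runs c s t s'" "t \<le> T" "I s'" "\<mu> s' < \<mu> s"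
      using body[OF Suc.prems(1) True] unfolding wp_def by auto
    then have "\<mu> s' < k" using Suc.prems by simp
    then obtain t' s'' where 2: "runs (While b c) s' t' s''" "I s''" "\<not> bval b s''" "t' \<le> k * R"
      using Suc.IH[OF 1(3)] unfolding wp_def by auto
    have "runs (While b c) s (1 + bcost b + t + t') s''"
      using True 1(1) 2(1) by (rule runs.WhileTrue)
    moreover have "1 + bcost b + t + t' \<le> Suc k * R"
      using 1(2) 2(4) time by simp
    ultimately show ?thesis unfolding wp_def using 2(2,3) by blast
  qed
qed simp

section \<open>Counting loops\<close>

notation com.Seq (infixr ";;" 60)

definition Eq :: "aexp \<Rightarrow> aexp \<Rightarrow> bexp" where
  "Eq a b = BAnd (BNot (Less a b)) (BNot (Less b a))"

lemma bval_Eq [simp]: "bval (Eq a b) s \<longleftrightarrow> aval a s = aval b s"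
  by (auto simp: Eq_def)

lemma bcost_Eq [simp]: "bcost (Eq a b) = 5 + 2 * acost a + 2 * acost b"
  by (simp add: Eq_def)

abbreviation Var :: "string \<Rightarrow> aexp" where
  "Var x \<equiv> Cell x (Num 0)"

abbreviation Set :: "string \<Rightarrow> aexp \<Rightarrow> com" where
  "Set x a \<equiv> Assign x (Num 0) a"

definition For :: "string \<Rightarrow> aexp \<Rightarrow> com \<Rightarrow> com" where
  "For x a c = Seq (Set x (Num 0))
     (While (Less (Var x) a) (Seq c (Set x (Add (Var x) (Num 1)))))"

lemma writes_For [simp]: "writes (For x a c) = insert x (writes c)"
  by (auto simp: For_def)

text \<open>The counter lives in an ordinary cell, so the body must be shown to leave it at
  \<open>k\<close>; the invariant is then demanded of the state whose counter has advanced to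
  \<open>Suc k\<close>. The bound \<open>a\<close> is evaluated before each iteration and must keep
  its value \<open>h\<close> under all that the loop may change. Charging \<open>X\<close> rounds
  instead of \<open>h + 1\<close> expresses all loop times in one size parameter; the surplus 20
  covers test, increment and initialisation.\<close>

lemma wp_For:
  fixes I :: "nat \<Rightarrow> state \<Rightarrow> bool"
  assumes init: "I 0 (s(x := (s x)(0 := 0)))"
    and body: "\<And>k s'. k < h \<Longrightarrow> I k s' \<Longrightarrow> s' x 0 = k \<Longrightarrow>
      (\<And>y. y \<notin> writes c \<Longrightarrow> y \<noteq> x \<Longrightarrow> s' y = s y) \<Longrightarrow>
      wp c T (\<lambda>s''. s'' x 0 = k \<and> I (Suc k) (s''(x := (s'' x)(0 := Suc k)))) s'"
    and bound: "\<And>s'. (\<And>y. y \<notin> writes c \<Longrightarrow> y \<noteq> x \<Longrightarrow> s' y = s y) \<Longrightarrow> aval a s' = h"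
    and post: "\<And>s'. I h s' \<Longrightarrow> (\<And>y. y \<notin> writes c \<Longrightarrow> y \<noteq> x \<Longrightarrow> s' y = s y) \<Longrightarrow> Q s'"
    and time: "h < X" "T + 20 + acost a \<le> R"
  shows "wp (For x a c) (X * R) Q s"
proof -
  define frame where "frame s' \<longleftrightarrow> (\<forall>y. y \<notin> writes c \<longrightarrow> y \<noteq> x \<longrightarrow> s' y = s y)" for s' :: state
  let ?I = "\<lambda>s'. s' x 0 \<le> h \<and> I (s' x 0) s' \<and> frame s'"
  let ?\<mu> = "\<lambda>s'. h - s' x 0"
  let ?b = "Less (Var x) a" and ?c = "Seq c (Set x (Add (Var x) (Num 1)))"
  let ?s = "s(x := (s x)(0 := 0))"
  have "wp (While ?b ?c) ((h + 1) * (T + 10 + acost a)) (\<lambda>s. ?I s \<and> \<not> bval ?b s) ?s"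
  proof (rule wp_While[where \<mu> = ?\<mu>])
    show "?I ?s" using init by (simp add: frame_def)
    show "h - ?s x 0 < h + 1" by simp
    show "(T + 6) + 1 + bcost ?b \<le> T + 10 + acost a" by simp
    fix s' assume s': "?I s'" and "bval ?b s'"
    then have less: "s' x 0 < h" using bound[of s'] by (auto simp: frame_def)
    have "wp c T (\<lambda>s''. s'' x 0 = s' x 0 \<and> I (Suc (s' x 0)) (s''(x := (s'' x)(0 := Suc (s' x 0))))) s'"
      using s' less by (intro body) (auto simp: frame_def)
    then have "wp c T (\<lambda>s''. frame s'' \<and> s'' x 0 = s' x 0 \<and>
        I (Suc (s' x 0)) (s''(x := (s'' x)(0 := Suc (s' x 0))))) s'"
      using s' by (elim wp_conseq) (auto simp: frame_def)
    then have "wp c T (wp (Set x (Add (Var x) (Num 1))) 6 (\<lambda>s''. ?I s'' \<and> ?\<mu> s'' < ?\<mu> s')) s'"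
    proof (rule wp_mono)
      fix s'' assume a: "frame s'' \<and> s'' x 0 = s' x 0 \<and>
        I (Suc (s' x 0)) (s''(x := (s'' x)(0 := Suc (s' x 0))))"
      show "wp (Set x (Add (Var x) (Num 1))) 6 (\<lambda>s''. ?I s'' \<and> ?\<mu> s'' < ?\<mu> s') s''"
        by (rule wp_exec) (use a less in \<open>auto simp: frame_def\<close>)
    qed
    then show "wp ?c (T + 6) (\<lambda>s''. ?I s'' \<and> ?\<mu> s'' < ?\<mu> s') s'"
      by (rule wp_Seq) simp
  qed
  then have "wp (While ?b ?c) ((h + 1) * (T + 10 + acost a)) Q ?s"
  proof (rule wp_mono)
    fix s' assume s': "?I s' \<and> \<not> bval ?b s'"
    then have "s' x 0 = h" using bound[of s'] by (auto simp: frame_def)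
    with s' show "Q s'" using post[of s'] by (auto simp: frame_def)
  qed
  then have "wp (Set x (Num 0)) 3 (wp (While ?b ?c) ((h + 1) * (T + 10 + acost a)) Q) s"
    by (intro wp_exec[where Q = "wp _ _ _"]) auto
  moreover have "3 + (h + 1) * (T + 10 + acost a) \<le> X * R"
  proof -
    have "3 + (h + 1) * (T + 10 + acost a) \<le> (h + 1) * (T + 20 + acost a)"
      by (simp add: algebra_simps)
    also have "\<dots> \<le> X * R" using time by (intro mult_le_mono) auto
    finally show ?thesis .
  qed
  ultimately show ?thesis unfolding For_def by (rule wp_Seq)
qed

section \<open>Vertex covers and codes from matchings\<close>

definition vertex_cover :: "ugraph \<Rightarrow> nat set \<Rightarrow> bool" where
  "vertex_cover G S \<longleftrightarrow> S \<subseteq> verts G \<and> (\<forall>e\<in>edges G. e \<inter> S \<noteq> {})"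

lemma finite_verts [simp]: "finite (verts G)"
  by (simp add: verts_def)

lemma simple_graph_edge:
  assumes "simple_graph G" "{x, y} \<in> edges G"
  shows "x \<in> verts G" "y \<in> verts G" "x \<noteq> y"
  using assms by (auto simp: simple_graph_def card_insert_if split: if_splits dest!: bspec)

lemma finite_edges: "simple_graph G \<Longrightarrow> finite (edges G)"
  unfolding simple_graph_def by (rule finite_subset[of _ "Pow (verts G)"]) auto

text \<open>Choose a cover vertex on every matching edge; disjoint edges yield different
  choices.\<close>

lemma matching_le_vertex_cover:
  assumes "matching G M" "vertex_cover G S"
  shows "card M \<le> card S"
proof -
  have "\<forall>e\<in>M. \<exists>x. x \<in> e \<inter> S"
    using assms by (force simp: matching_def vertex_cover_def)
  then obtain h where h: "\<And>e. e \<in> M \<Longrightarrow> h e \<in> e \<inter> S"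
    by (metis bchoice)
  have "inj_on h M"
    using assms(1) h unfolding matching_def disjoint_def inj_on_def by (metis IntD1 IntI emptyE)
  moreover have "h ` M \<subseteq> S" using h by auto
  moreover have "finite S" using assms(2) finite_subset[of S "verts G"] by (simp add: vertex_cover_def)
  ultimately show ?thesis by (rule card_inj_on_le)
qed

text \<open>By weak duality, a matching and a cover of equal size certify each other as
  optimal.\<close>

lemma matching_number_eqI:
  assumes "simple_graph G" "matching G M" "vertex_cover G S" "card M = card S"
  shows "matching_number G = card M"
  unfolding matching_number_def
proof (rule Max_eqI)
  have "{card N |N. matching G N} \<subseteq> card ` Pow (edges G)"
    by (auto simp: matching_def)
  then show "finite {card N |N. matching G N}"
    by (rule finite_subset) (simp add: finite_edges assms(1))
  show "card M \<in> {card N |N. matching G N}" using assms(2) by blast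
qed (use assms matching_le_vertex_cover[of G _ S] in auto)

lemma is_FqD:
  assumes "is_Fq q F"
  shows "field F" "finite (carrier F)" "card (carrier F) = q" "order F = q" "1 < q"
proof -
  show 1: "field F" "finite (carrier F)" "order F = q" "card (carrier F) = q"
    using assms by (auto simp: is_Fq_def order_def)
  interpret field F by fact
  \<comment> \<open>Zero and one differ, so \<open>q\<close> is a proper base for the logarithm in
    \<open>code_dim\<close>.\<close>
  have "card {\<zero>\<^bsub>F\<^esub>, \<one>\<^bsub>F\<^esub>} \<le> card (carrier F)"
    using 1 by (intro card_mono) auto
  then show "1 < q" using 1(4) by simp
qed

text \<open>A vertex outside a vertex cover has all its neighbours in the cover, so the coordinates
  in the cover determine a codeword.\<close>

lemma card_rdss_code_le:
  assumes F: "is_Fq q F" and C: "rdss_code F G C" and S: "vertex_cover G S"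
  shows "card C \<le> q ^ card S"
proof -
  obtain f where f: "\<And>i X. i \<in> verts G \<Longrightarrow> X \<in> C \<Longrightarrow> X i = f i (restrict X (nbrs G i))"
    and CV: "C \<subseteq> verts G \<rightarrow>\<^sub>E carrier F"
    using C unfolding rdss_code_def recovers_def by blast
  have SV: "S \<subseteq> verts G" using S by (simp add: vertex_cover_def)
  have fin: "finite S" using SV by (rule finite_subset) simp
  have "inj_on (\<lambda>X. restrict X S) C"
  proof (rule inj_onI)
    fix X Y assume X: "X \<in> C" and Y: "Y \<in> C" and eq: "restrict X S = restrict Y S"
    have agree: "X j = Y j" if "j \<in> S" for j
      using fun_cong[OF eq, of j] that by simp
    show "X = Y"
    proof (rule PiE_ext)
      show "X \<in> verts G \<rightarrow>\<^sub>E carrier F" "Y \<in> verts G \<rightarrow>\<^sub>E carrier F" using X Y CV by auto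
      fix i assume i: "i \<in> verts G"
      show "X i = Y i"
      proof (cases "i \<in> S")
        case False
        then have "nbrs G i \<subseteq> S" using S by (auto simp: vertex_cover_def nbrs_def)
        then have "restrict X (nbrs G i) = restrict Y (nbrs G i)"
          using agree by (intro restrict_ext) auto
        then show ?thesis using f[OF i X] f[OF i Y] by simp
      qed (rule agree)
    qed
  qed
  moreover have "(\<lambda>X. restrict X S) ` C \<subseteq> S \<rightarrow>\<^sub>E carrier F"
    using CV SV by fastforce
  moreover have "finite (S \<rightarrow>\<^sub>E carrier F)"
    using fin is_FqD(2)[OF F] by (intro finite_PiE)
  ultimately have "card C \<le> card (S \<rightarrow>\<^sub>E carrier F)"
    by (rule card_inj_on_le)
  then show ?thesis using fin is_FqD(3)[OF F] by (simp add: card_PiE)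
qed

lemma code_dim_le:
  assumes "is_Fq q F" "rdss_code F G C" "C \<noteq> {}" "vertex_cover G S"
  shows "code_dim F C \<le> real (card S)"
proof -
  have "finite C"
    using assms(2) is_FqD(2)[OF assms(1)] finite_subset[of C "verts G \<rightarrow>\<^sub>E carrier F"]
    by (simp add: rdss_code_def finite_PiE)
  then have pos: "0 < card C" using assms(3) by (simp add: card_gt_0_iff)
  have q: "1 < q" and ord: "order F = q" using is_FqD[OF assms(1)] by auto
  have "real (card C) \<le> real q ^ card S"
    using card_rdss_code_le[OF assms(1,2,4)] by (metis of_nat_le_iff of_nat_power)
  then have "log (real q) (real (card C)) \<le> log (real q) (real q ^ card S)"
    using pos q by (subst log_le_cancel_iff) auto
  also have "\<dots> = real (card S)" using q by (simp add: log_nat_power)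
  finally show ?thesis by (simp add: code_dim_def ord)
qed

text \<open>Codes obey the same weak duality as matchings. The set under \<open>Max\<close> is
  finite because all codes lie in one finite vector space.\<close>

lemma CAP_eqI:
  assumes F: "is_Fq q F" and C: "rdss_code F G C" "C \<noteq> {}" and S: "vertex_cover G S"
    and dim: "code_dim F C = real (card S)"
  shows "CAP F G = real (card S)"
  unfolding CAP_def
proof (rule Max_eqI)
  have "{code_dim F C |C. rdss_code F G C \<and> C \<noteq> {}}
      \<subseteq> code_dim F ` Pow (verts G \<rightarrow>\<^sub>E carrier F)"
    by (auto simp: rdss_code_def)
  then show "finite {code_dim F C |C. rdss_code F G C \<and> C \<noteq> {}}"
    by (rule finite_subset) (simp add: finite_PiE is_FqD(2)[OF F])
  show "real (card S) \<in> {code_dim F C |C. rdss_code F G C \<and> C \<noteq> {}}"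
    using C dim by (intro CollectI exI[of _ C]) simp
qed (use code_dim_le[OF F _ _ S] in auto)

text \<open>The content of a vertex is the message symbol \<open>idx i\<close> of its matching edge, and it is
  recovered from its partner \<open>pt i\<close>; the value \<open>0\<close> marks unmatched vertices.\<close>

definition var_or_zero :: "nat \<Rightarrow> fexp" where
  "var_or_zero j = (if j = 0 then FZero else FVar j)"

definition pairing_code :: "nat \<Rightarrow> (nat \<Rightarrow> nat) \<Rightarrow> (nat \<Rightarrow> nat) \<Rightarrow> code_desc" where
  "pairing_code k idx pt =
     \<lparr>msg_len = k, enc = \<lambda>i. var_or_zero (idx i), recov = \<lambda>i. var_or_zero (pt i)\<rparr>"

text \<open>Recovery rests on \<open>idx (pt i) = idx i\<close>. The last clause stores every
  message symbol somewhere and so makes the encoder injective.\<close>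

definition pairing :: "ugraph \<Rightarrow> nat \<Rightarrow> (nat \<Rightarrow> nat) \<Rightarrow> (nat \<Rightarrow> nat) \<Rightarrow> bool" where
  "pairing G k idx pt \<longleftrightarrow>
     (\<forall>i\<in>verts G. if pt i = 0 then idx i = 0
        else pt i \<in> nbrs G i \<and> idx (pt i) = idx i \<and> idx i \<in> {1..k}) \<and>
     {1..k} \<subseteq> idx ` verts G"

lemma
  assumes F: "is_Fq q F" and pairing: "pairing G k idx pt"
  shows describes_pairing_code: "describes_rdss_code F G (pairing_code k idx pt)"
    and code_dim_pairing_code: "code_dim F (described_code F G (pairing_code k idx pt)) = real k"
    and pairing_code_nonempty: "described_code F G (pairing_code k idx pt) \<noteq> {}"
proof -
  interpret field F using is_FqD(1)[OF F] .
  let ?D = "pairing_code k idx pt"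
  have unmatched: "idx i = 0" if "i \<in> verts G" "pt i = 0" for i
    using pairing that by (auto simp: pairing_def)
  have matched: "pt i \<in> nbrs G i" "idx (pt i) = idx i" "idx i \<in> {1..k}"
    if "i \<in> verts G" "pt i \<noteq> 0" for i
    using pairing that by (auto simp: pairing_def split: if_splits)
  have enc: "encode F G ?D w i = (if idx i = 0 then \<zero>\<^bsub>F\<^esub> else w (idx i))" if "i \<in> verts G" for w i
    using that by (simp add: encode_def pairing_code_def var_or_zero_def)
  have closed: "encode F G ?D w i \<in> carrier F" if "i \<in> verts G" "w \<in> messages F ?D" for w i
    using enc[of i w] that matched(3)[of i] unmatched[of i]
    by (cases "pt i = 0") (auto simp: messages_def pairing_code_def)
  have inj: "inj_on (encode F G ?D) (messages F ?D)"
  proof (rule inj_onI)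
    fix w w' assume w: "w \<in> messages F ?D" "w' \<in> messages F ?D"
      and eq: "encode F G ?D w = encode F G ?D w'"
    show "w = w'"
    proof (rule PiE_ext)
      show "w \<in> {1..k} \<rightarrow>\<^sub>E carrier F" "w' \<in> {1..k} \<rightarrow>\<^sub>E carrier F"
        using w by (auto simp: messages_def pairing_code_def)
      fix l assume l: "l \<in> {1..k}"
      then obtain i where "i \<in> verts G" "idx i = l"
        using pairing by (auto simp: pairing_def)
      then show "w l = w' l" using fun_cong[OF eq, of i] enc[of i] l by simp
    qed
  qed
  have rec: "recovers F G (\<lambda>i Y. feval F Y (recov ?D i)) (described_code F G ?D)"
    unfolding recovers_def
  proof (intro ballI conjI funcsetI)
    fix i Y assume i: "i \<in> verts G" and Y: "Y \<in> nbrs G i \<rightarrow>\<^sub>E carrier F"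
    show "feval F Y (recov ?D i) \<in> carrier F"
      using matched(1)[OF i] Y by (auto simp: pairing_code_def var_or_zero_def)
  next
    fix i X assume i: "i \<in> verts G" and "X \<in> described_code F G ?D"
    then obtain w where X: "X = encode F G ?D w"
      by (auto simp: described_code_def)
    show "X i = feval F (restrict X (nbrs G i)) (recov ?D i)"
    proof (cases "pt i = 0")
      case True
      then show ?thesis
        using enc[OF i] unmatched[OF i] by (simp add: X pairing_code_def var_or_zero_def)
    next
      case False
      then have "pt i \<in> verts G" using matched(1)[OF i] by (simp add: nbrs_def)
      then show ?thesis
        using False enc[OF i] enc[of "pt i"] matched[OF i]
        by (simp add: X pairing_code_def var_or_zero_def)
    qed
  qed
  moreover have "described_code F G ?D \<subseteq> verts G \<rightarrow>\<^sub>E carrier F"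
    using closed by (auto simp: described_code_def encode_def)
  ultimately have "rdss_code F G (described_code F G ?D)"
    by (auto simp: rdss_code_def)
  moreover have "fvars (enc ?D i) \<subseteq> {1..msg_len ?D} \<and> fvars (recov ?D i) \<subseteq> nbrs G i"
    if "i \<in> verts G" for i
    using matched[OF that] unmatched[OF that]
    by (cases "pt i = 0") (auto simp: pairing_code_def var_or_zero_def)
  ultimately show "describes_rdss_code F G ?D"
    using inj rec by (auto simp: describes_rdss_code_def)
  have "card (messages F ?D) = q ^ k"
    using is_FqD(3)[OF F] by (simp add: messages_def pairing_code_def card_PiE)
  then have card: "card (described_code F G ?D) = q ^ k"
    using inj by (simp add: described_code_def card_image)
  then show "code_dim F (described_code F G ?D) = real k"
    using is_FqD(4,5)[OF F] by (simp add: code_dim_def log_nat_power)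
  show "described_code F G ?D \<noteq> {}"
    using card is_FqD(5)[OF F] by force
qed

lemma tokens_var_or_zero: "tokens (var_or_zero j) = (if j = 0 then [1] else [3, j])"
  by (simp add: var_or_zero_def)

lemma desc_tokens_pairing_code:
  "desc_tokens G (pairing_code k idx pt) =
     k # concat (map (\<lambda>i. tokens (var_or_zero (idx i))) [1..<Suc (nverts G)]) @
     concat (map (\<lambda>i. tokens (var_or_zero (pt i))) [1..<Suc (nverts G)])"
  by (simp add: desc_tokens_def pairing_code_def)

section \<open>The auction\<close>

text \<open>All left vertices below \<open>a\<close> have been processed, except for the current bidder \<open>cur\<close>; those
  without a mate have given up. There is no vertex \<open>0\<close>, so it serves as a null value; its price \<open>L\<close>
  makes it the outcome of a search for a cheaper neighbour that finds none.\<close>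

locale auction =
  fixes G :: ugraph and A :: "nat set" and L a cur :: nat and mate p :: "nat \<Rightarrow> nat"
  assumes mate_edge: "mate b \<noteq> 0 \<Longrightarrow> {b, mate b} \<in> edges G"
    and mate_left: "mate b \<noteq> 0 \<Longrightarrow> mate b \<in> A"
    and mate_less: "mate b \<noteq> 0 \<Longrightarrow> mate b < a"
    and mate_not_cur: "mate b \<noteq> 0 \<Longrightarrow> mate b \<noteq> cur"
    and mate_inj: "mate b \<noteq> 0 \<Longrightarrow> mate b = mate c \<Longrightarrow> b = c"
    and price_0: "p 0 = L"
    and price_le: "p b \<le> L"
    and price_pos: "b \<noteq> 0 \<Longrightarrow> p b \<noteq> 0 \<Longrightarrow> mate b \<noteq> 0"
    and slack: "mate b \<noteq> 0 \<Longrightarrow> {c, mate b} \<in> edges G \<Longrightarrow> p b \<le> Suc (p c)"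
    and settled: "x \<in> A \<Longrightarrow> x < a \<Longrightarrow> x \<noteq> cur \<Longrightarrow>
      (\<exists>b. mate b = x) \<or> (\<forall>b. {b, x} \<in> edges G \<longrightarrow> p b = L)"
    and cur_left: "cur \<noteq> 0 \<Longrightarrow> cur \<in> A"
    and cur_less: "cur \<noteq> 0 \<Longrightarrow> cur < a"

definition cheapest :: "ugraph \<Rightarrow> nat \<Rightarrow> nat \<Rightarrow> (nat \<Rightarrow> nat) \<Rightarrow> nat \<Rightarrow> bool" where
  "cheapest G L cur p best \<longleftrightarrow>
     (if best = 0 then \<forall>b. {b, cur} \<in> edges G \<longrightarrow> L \<le> p b
      else {best, cur} \<in> edges G \<and> p best < L \<and> (\<forall>b. {b, cur} \<in> edges G \<longrightarrow> p best \<le> p b))"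

lemma auction_start:
  assumes "auction G A L a 0 mate p" "0 \<notin> A"
  shows "auction G A L (Suc a) (if a \<in> A then a else 0) mate p"
proof -
  interpret auction G A L a 0 mate p by fact
  show ?thesis
  proof
    fix b assume b: "mate b \<noteq> 0"
    then have "mate b < a" by (rule mate_less)
    then show "mate b < Suc a" "mate b \<noteq> (if a \<in> A then a else 0)" using b by auto
  next
    \<comment> \<open>With a null bidder the old \<open>settled\<close> says nothing about
      \<open>x = 0\<close>, which \<open>0 \<notin> A\<close> rules out. For \<open>x = a\<close>
      the assumptions contradict each other.\<close>
    fix x assume "x \<in> A" "x < Suc a" "x \<noteq> (if a \<in> A then a else 0)"
    then show "(\<exists>b. mate b = x) \<or> (\<forall>b. {b, x} \<in> edges G \<longrightarrow> p b = L)"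
      using settled[of x] assms(2) by (cases "x = a") (auto split: if_splits)
  next
    show "(if a \<in> A then a else 0) \<in> A" "(if a \<in> A then a else 0) < Suc a"
      if "(if a \<in> A then a else 0) \<noteq> 0" using that by (auto split: if_splits)
  qed (fact mate_edge mate_left mate_inj price_0 price_le price_pos slack)+
qed

lemma auction_give_up:
  assumes "auction G A L a cur mate p" "cheapest G L cur p 0"
  shows "auction G A L a 0 mate p"
proof -
  interpret auction G A L a cur mate p by fact
  show ?thesis
  proof
    fix x assume x: "x \<in> A" "x < a" "x \<noteq> 0"
    show "(\<exists>b. mate b = x) \<or> (\<forall>b. {b, x} \<in> edges G \<longrightarrow> p b = L)"
    proof (cases "x = cur")
      case True
      then show ?thesis using assms(2) price_le by (auto simp: cheapest_def intro: le_antisym)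
    qed (use settled x in blast)
  qed (fact mate_edge mate_left mate_less mate_inj price_0 price_le price_pos slack | simp)+
qed

text \<open>The new price exceeds the cheapest one by one, which is just what \<open>slack\<close>
  allows, and prices on the right of \<open>slack\<close> can only have grown. The displaced owner
  becomes the bidder, or \<open>0\<close> if \<open>best\<close> was free;
  \<open>mate_not_cur\<close> keeps \<open>mate\<close> injective. A vertex that has given up stays
  settled: its neighbours all cost \<open>L\<close>, so \<open>best\<close> with
  \<open>p best < L\<close> is none of them.\<close>

lemma auction_bid:
  assumes auction: "auction G A L a cur mate p" and best: "cheapest G L cur p best"
    and nz: "best \<noteq> 0" "cur \<noteq> 0"
  shows "auction G A L a (mate best) (mate(best := cur)) (p(best := Suc (p best)))"
proof -
  interpret auction G A L a cur mate p by fact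
  have b: "{best, cur} \<in> edges G" "p best < L" "\<And>b. {b, cur} \<in> edges G \<Longrightarrow> p best \<le> p b"
    using best nz by (simp_all add: cheapest_def)
  let ?mate = "mate(best := cur)" and ?p = "p(best := Suc (p best))"
  show ?thesis
  proof
    fix c assume c: "?mate c \<noteq> 0"
    show "{c, ?mate c} \<in> edges G" using c b(1) mate_edge[of c] by (cases "c = best") auto
    show "?mate c \<in> A" using c cur_left mate_left[of c] by (cases "c = best") auto
    show "?mate c < a" using c cur_less mate_less[of c] by (cases "c = best") auto
    show "?mate c \<noteq> mate best"
      using c nz mate_not_cur[of best] mate_inj[of c best] by (cases "c = best") auto
    fix c'
    show "c = c'" if "?mate c = ?mate c'"
      using that c mate_not_cur[of c] mate_not_cur[of c'] mate_inj[of c c'] nz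
      by (cases "c = best"; cases "c' = best") auto
    show "?p c \<le> Suc (?p c')" if "{c', ?mate c} \<in> edges G"
    proof (cases "c = best")
      case True
      then show ?thesis using that b(3)[of c'] by simp
    next
      case False
      then have "p c \<le> Suc (p c')" using that c slack[of c c'] by simp
      then show ?thesis using False by auto
    qed
  next
    show "?p 0 = L" using nz price_0 by simp
    show "?p c \<le> L" for c using price_le b(2) by simp
    show "?mate c \<noteq> 0" if "c \<noteq> 0" "?p c \<noteq> 0" for c
      using that price_pos nz by (cases "c = best") simp_all
    show "mate best \<in> A" "mate best < a" if "mate best \<noteq> 0"
      using that mate_left mate_less by auto
  next
    fix x assume x: "x \<in> A" "x < a" "x \<noteq> mate best"
    show "(\<exists>b. ?mate b = x) \<or> (\<forall>b. {b, x} \<in> edges G \<longrightarrow> ?p b = L)"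
    proof (cases "x = cur")
      case True
      then show ?thesis by (intro disjI1 exI[of _ best]) simp
    next
      case False
      from settled[OF x(1,2) False] show ?thesis
      proof
        assume "\<exists>b. mate b = x"
        then obtain c where "mate c = x" ..
        then have "?mate c = x" using x(3) by auto
        then show ?thesis by blast
      next
        assume *: "\<forall>b. {b, x} \<in> edges G \<longrightarrow> p b = L"
        then have "?p c = L" if "{c, x} \<in> edges G" for c
          using that b(2) by (cases "c = best") auto
        then show ?thesis by blast
      qed
    qed
  qed
qed

text \<open>Only matched vertices have a positive price, so some level \<open>k\<close> between \<open>1\<close> and \<open>L\<close>
  is not the price of any vertex. Cutting at \<open>k\<close> separates the matching into edges covered on the
  right and edges covered on the left.\<close>

lemma auction_vertex_cover:
  assumes G: "simple_graph G"
    and A: "A \<subseteq> verts G" "\<And>x y. {x, y} \<in> edges G \<Longrightarrow> (x \<in> A) \<noteq> (y \<in> A)"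
    and auction: "auction G A L (Suc (nverts G)) 0 mate p" and L: "nverts G < L"
  obtains S where "vertex_cover G S" "card S = card {b. mate b \<noteq> 0}"
proof -
  interpret auction G A L "Suc (nverts G)" 0 mate p by fact
  have edge: "{b, mate b} \<in> edges G" "mate b \<in> A" "b \<in> verts G" "b \<notin> A" if "mate b \<noteq> 0" for b
    using mate_edge[OF that] mate_left[OF that] simple_graph_edge(1)[OF G] A(2) by blast+
  have "\<not> {1..L} \<subseteq> p ` verts G"
  proof
    assume "{1..L} \<subseteq> p ` verts G"
    then have "card {1..L} \<le> card (p ` verts G)" by (intro card_mono) auto
    also have "\<dots> \<le> nverts G"
      using card_image_le[of "verts G" p] by (simp add: verts_def)
    finally show False using L by simp
  qed
  then obtain k where "k \<in> {1..L}" "k \<notin> p ` verts G" by blast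
  then have k: "1 \<le> k" "k \<le> L" "\<And>b. b \<in> verts G \<Longrightarrow> p b \<noteq> k" by auto
  define B where "B = {b. mate b \<noteq> 0}"
  \<comment> \<open>One endpoint of every matching edge: the right one if its price lies above the
    cut, else the left one.\<close>
  define h where "h b = (if k < p b then b else mate b)" for b
  have "inj_on h B"
  proof (rule inj_onI)
    fix b c assume "b \<in> B" "c \<in> B" "h b = h c"
    then show "b = c"
      using edge(2,4)[of b] edge(2,4)[of c] mate_inj[of b c] by (auto simp: h_def B_def split: if_splits)
  qed
  then have "card (h ` B) = card B" by (rule card_image)
  moreover have "vertex_cover G (h ` B)"
    unfolding vertex_cover_def
  proof (intro conjI ballI)
    show "h ` B \<subseteq> verts G" using edge A(1) by (auto simp: h_def B_def)
    fix e assume e: "e \<in> edges G"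
    then obtain x y where xy: "e = {x, y}" using G by (auto simp: simple_graph_def card_2_iff)
    then obtain a b where ab: "e = {b, a}" "a \<in> A"
      using A(2)[of x y] e by (metis insert_commute)
    have edge_ab: "{b, a} \<in> edges G" using e ab by simp
    have b_nz: "b \<in> verts G" "b \<noteq> 0" and a: "a < Suc (nverts G)" "a \<noteq> 0"
      using simple_graph_edge[OF G edge_ab] by (auto simp: verts_def)
    show "e \<inter> h ` B \<noteq> {}"
    proof (cases "k < p b")
      case True
      then have "b \<in> B" "h b = b" using price_pos[of b] b_nz by (auto simp: B_def h_def)
      then have "b \<in> e \<inter> h ` B" using ab by force
      then show ?thesis by blast
    next
      case False
      \<comment> \<open>No vertex costs exactly \<open>k\<close>, so here the price is at most
        \<open>k - 1\<close>. Hence \<open>a\<close> has a neighbour below the cap and cannot have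
        given up, and \<open>slack\<close> lets the vertex that it holds cost at most
        \<open>k\<close>, which puts \<open>a\<close> itself into the cover.\<close>
      then have "p b < k" using k(3)[OF b_nz(1)] by simp
      then have "p b \<noteq> L" using k(2) by simp
      then obtain c where c: "mate c = a" using settled[OF ab(2) a] edge_ab by blast
      then have "p c \<le> Suc (p b)" using slack[of c b] a(2) edge_ab by simp
      then have "\<not> k < p c" using \<open>p b < k\<close> by simp
      then have "h c = a" "c \<in> B" using c a(2) by (auto simp: h_def B_def)
      then have "a \<in> e \<inter> h ` B" using ab by force
      then show ?thesis by blast
    qed
  qed
  ultimately show ?thesis using that unfolding B_def by blast
qed

text \<open>Right ends lie outside \<open>A\<close> and mates inside, so two such edges can meet
  only in equal right ends or equal mates; by \<open>mate_inj\<close> they coincide in both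
  cases.\<close>

lemma auction_matching:
  assumes A: "\<And>x y. {x, y} \<in> edges G \<Longrightarrow> (x \<in> A) \<noteq> (y \<in> A)"
    and auction: "auction G A L a cur mate p"
  obtains M where "matching G M" "card M = card {b. mate b \<noteq> 0}"
proof -
  interpret auction G A L a cur mate p by fact
  have edge: "{b, mate b} \<in> edges G" "mate b \<in> A" "b \<notin> A" if "mate b \<noteq> 0" for b
    using mate_edge[OF that] mate_left[OF that] A by blast+
  define e where "e b = {b, mate b}" for b
  have disj: "b = c" if "mate b \<noteq> 0" "mate c \<noteq> 0" "e b \<inter> e c \<noteq> {}" for b c
    using that edge[of b] edge[of c] mate_inj[of b c] by (auto simp: e_def)
  have "b = c" if "mate b \<noteq> 0" "mate c \<noteq> 0" "e b = e c" for b c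
    using disj[OF that(1,2)] that(3) by (auto simp: e_def)
  then have "inj_on e {b. mate b \<noteq> 0}" by (simp add: inj_on_def)
  then have "card (e ` {b. mate b \<noteq> 0}) = card {b. mate b \<noteq> 0}" by (rule card_image)
  moreover have "matching G (e ` {b. mate b \<noteq> 0})"
    unfolding matching_def disjoint_def
  proof (intro conjI ballI impI subsetI)
    show "x \<in> edges G" if "x \<in> e ` {b. mate b \<noteq> 0}" for x
      using that edge(1) by (auto simp: e_def)
    fix x y assume "x \<in> e ` {b. mate b \<noteq> 0}" "y \<in> e ` {b. mate b \<noteq> 0}" "x \<noteq> y"
    then show "x \<inter> y = {}" using disj by blast
  qed
  ultimately show ?thesis using that by blast
qed

section \<open>The program\<close>

text \<open>Most vertex loops also visit the null index 0, hence this bound; the same value is the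
  price cap.\<close>

abbreviation n_plus_1 :: aexp where
  "n_plus_1 \<equiv> Add (Var ''n'') (Num 1)"

definition relabel :: com where
  "relabel =
     If (Eq (Cell ''comp'' (Var ''w'')) (Var ''old''))
       (Assign ''comp'' (Var ''w'') (Var ''new'') ;;
        If (Less (Num 0) (Var ''flip''))
          (Assign ''col'' (Var ''w'') (Sub (Num 1) (Cell ''col'' (Var ''w''))))
          Skip)
       Skip"

text \<open>The class of \<open>v\<close> takes the label of the class of \<open>u\<close>, by a
  scan of all vertices, and is recoloured as a whole if the two endpoints have equal
  colours.\<close>

definition merge_edge :: com where
  "merge_edge =
     (Set ''new'' (Cell ''comp'' (Cell ''u'' (Var ''j''))) ;;
      Set ''old'' (Cell ''comp'' (Cell ''v'' (Var ''j''))) ;;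
      If (Eq (Cell ''col'' (Cell ''u'' (Var ''j''))) (Cell ''col'' (Cell ''v'' (Var ''j''))))
        (Set ''flip'' (Num 1)) (Set ''flip'' (Num 0))) ;;
     For ''w'' n_plus_1 relabel"

definition two_colour :: com where
  "two_colour =
     For ''w'' n_plus_1 (Assign ''comp'' (Var ''w'') (Var ''w'')) ;;
     For ''j'' (Var ''m'') merge_edge"

text \<open>An edge not incident with \<open>cur\<close> leaves \<open>w\<close> at 0, whose price
  is the cap and thus never below that of \<open>best\<close>. Endpoints come in either order, hence
  two tests.\<close>

definition inspect :: com where
  "inspect =
     Set ''w'' (Num 0) ;;
     If (Eq (Cell ''u'' (Var ''j'')) (Var ''cur'')) (Set ''w'' (Cell ''v'' (Var ''j''))) Skip ;;
     If (Eq (Cell ''v'' (Var ''j'')) (Var ''cur'')) (Set ''w'' (Cell ''u'' (Var ''j''))) Skip ;;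
     If (Less (Cell ''price'' (Var ''w'')) (Cell ''price'' (Var ''best'')))
       (Set ''best'' (Var ''w'')) Skip"

definition find_cheapest :: com where
  "find_cheapest = Set ''best'' (Num 0) ;; For ''j'' (Var ''m'') inspect"

definition bid :: com where
  "bid =
     If (Less (Num 0) (Var ''best''))
       (Set ''prev'' (Cell ''mate'' (Var ''best'')) ;;
        Assign ''mate'' (Var ''best'') (Var ''cur'') ;;
        Assign ''price'' (Var ''best'') (Add (Cell ''price'' (Var ''best'')) (Num 1)) ;;
        Set ''cur'' (Var ''prev''))
       (Set ''cur'' (Num 0))"

text \<open>If index 0 has colour 0, \<open>cur\<close> becomes 0, which again means that there is
  no bidder.\<close>

definition start_bidder :: com where
  "start_bidder = Set ''cur'' (Num 0) ;;
     If (Eq (Cell ''col'' (Var ''a'')) (Num 0)) (Set ''cur'' (Var ''a'')) Skip"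

definition run_bidder :: com where
  "run_bidder = start_bidder ;; While (Less (Num 0) (Var ''cur'')) (find_cheapest ;; bid)"

definition run_auction :: com where
  "run_auction = Assign ''price'' (Num 0) n_plus_1 ;; For ''a'' n_plus_1 run_bidder"

definition number_pair :: com where
  "number_pair =
     If (Less (Num 0) (Cell ''mate'' (Var ''b'')))
       (Set ''k'' (Add (Var ''k'') (Num 1)) ;;
        Assign ''idx'' (Var ''b'') (Var ''k'') ;;
        Assign ''idx'' (Cell ''mate'' (Var ''b'')) (Var ''k'') ;;
        Assign ''pt'' (Var ''b'') (Cell ''mate'' (Var ''b'')) ;;
        Assign ''pt'' (Cell ''mate'' (Var ''b'')) (Var ''b''))
       Skip"

definition number_pairs :: com where
  "number_pairs = For ''b'' n_plus_1 number_pair"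

definition emit :: "aexp \<Rightarrow> com" where
  "emit a = Assign ''out'' (Var ''outlen'') a ;; Set ''outlen'' (Add (Var ''outlen'') (Num 1))"

text \<open>The output loop counts from 0 but vertices from 1, hence the index
  \<open>i + 1\<close>.\<close>

definition emit_var :: "string \<Rightarrow> com" where
  "emit_var x =
     If (Less (Num 0) (Cell x (Add (Var ''i'') (Num 1))))
       (emit (Num 3) ;; emit (Cell x (Add (Var ''i'') (Num 1))))
       (emit (Num 1))"

definition emit_vars :: "string \<Rightarrow> com" where
  "emit_vars x = For ''i'' (Var ''n'') (emit_var x)"

definition matching_code_program :: com where
  "matching_code_program =
     two_colour ;; run_auction ;; number_pairs ;;
     emit (Var ''k'') ;; emit_vars ''idx'' ;; emit_vars ''pt''"

lemma writes_program [simp]: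
  "writes relabel = {''comp'', ''col''}"
  "writes merge_edge = {''new'', ''old'', ''flip'', ''w'', ''comp'', ''col''}"
  "writes two_colour = {''new'', ''old'', ''flip'', ''w'', ''j'', ''comp'', ''col''}"
  "writes inspect = {''w'', ''best''}"
  "writes find_cheapest = {''w'', ''j'', ''best''}"
  "writes bid = {''prev'', ''mate'', ''price'', ''cur''}"
  "writes start_bidder = {''cur''}"
  "writes run_bidder = {''w'', ''j'', ''best'', ''prev'', ''mate'', ''price'', ''cur''}"
  "writes run_auction = {''w'', ''j'', ''best'', ''prev'', ''mate'', ''price'', ''cur'', ''a''}"
  "writes number_pair = {''k'', ''idx'', ''pt''}"
  "writes number_pairs = {''k'', ''idx'', ''pt'', ''b''}"
  "writes (emit e) = {''out'', ''outlen''}"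
  "writes (emit_var x) = {''out'', ''outlen''}"
  "writes (emit_vars x) = {''i'', ''out'', ''outlen''}"
  by (auto simp: relabel_def merge_edge_def two_colour_def inspect_def find_cheapest_def bid_def
      start_bidder_def run_bidder_def run_auction_def number_pair_def number_pairs_def emit_def
      emit_var_def emit_vars_def)

section \<open>Two-colouring by merging classes\<close>

text \<open>Two vertices with the same \<open>cl\<close> lie in the same part built so far. On each part the current
  colouring is either \<open>A\<close> or its complement, so two parts can be joined after recolouring one.\<close>

definition same_parity :: "nat \<Rightarrow> nat set \<Rightarrow> (nat \<Rightarrow> nat) \<Rightarrow> (nat \<Rightarrow> nat) \<Rightarrow> bool" where
  "same_parity n A cl col \<longleftrightarrow>
     (\<forall>x\<le>n. col x \<le> 1) \<and>
     (\<forall>x\<le>n. \<forall>y\<le>n. cl x = cl y \<longrightarrow> ((col x = 0 \<longleftrightarrow> x \<in> A) \<longleftrightarrow> (col y = 0 \<longleftrightarrow> y \<in> A)))"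

lemma same_parityD:
  assumes "same_parity n A cl col"
  shows "x \<le> n \<Longrightarrow> col x \<le> 1"
    and "x \<le> n \<Longrightarrow> y \<le> n \<Longrightarrow> cl x = cl y \<Longrightarrow>
      (col x = 0 \<longleftrightarrow> x \<in> A) \<longleftrightarrow> (col y = 0 \<longleftrightarrow> y \<in> A)"
proof -
  show "col x \<le> 1" if "x \<le> n"
    using assms that by (simp only: same_parity_def)
  show "(col x = 0 \<longleftrightarrow> x \<in> A) \<longleftrightarrow> (col y = 0 \<longleftrightarrow> y \<in> A)"
    if "x \<le> n" "y \<le> n" "cl x = cl y"
    by (rule assms[unfolded same_parity_def, THEN conjunct2, rule_format, OF that])
qed

text \<open>The endpoints lie on different sides of \<open>A\<close>, so the two classes are
  oriented alike exactly if the endpoints have different colours; otherwise the class of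
  \<open>b\<close> is flipped. This includes endpoints that share a class already: their colours
  then differ, and nothing changes.\<close>

lemma same_parity_merge:
  assumes sp: "same_parity n A cl col" and ab: "a \<le> n" "b \<le> n" "a \<in> A \<longleftrightarrow> b \<notin> A"
    and cl': "\<And>x. x \<le> n \<Longrightarrow> cl' x = (if cl x = cl b then cl a else cl x)"
    and col': "\<And>x. x \<le> n \<Longrightarrow>
      col' x = (if cl x = cl b \<and> col a = col b then 1 - col x else col x)"
  shows "same_parity n A cl' col'"
proof -
  note le = same_parityD(1)[OF sp] and agree = same_parityD(2)[OF sp]
  have flip: "col a = col b \<longleftrightarrow> (col a = 0 \<longleftrightarrow> col b = 0)"
    using le[OF ab(1)] le[OF ab(2)] by presburger
  \<comment> \<open>After the step the whole former class of \<open>b\<close> has the orientation of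
    \<open>a\<close>.\<close>
  have moved: "(col' x = 0 \<longleftrightarrow> x \<in> A) \<longleftrightarrow> (col a = 0 \<longleftrightarrow> a \<in> A)"
    if x: "x \<le> n" "cl x = cl b" for x
  proof (cases "col a = col b")
    case True
    then have "col' x = 0 \<longleftrightarrow> col x \<noteq> 0" using col'[OF x(1)] x(2) le[OF x(1)] True by auto
    then show ?thesis using agree[OF x(1) ab(2) x(2)] True ab(3)
      by (cases "col a = 0"; cases "col b = 0"; cases "x \<in> A"; cases "b \<in> A"; cases "col x = 0") simp_all
  next
    case False
    then have "col' x = col x" using col'[OF x(1)] by simp
    then show ?thesis using agree[OF x(1) ab(2) x(2)] False flip ab(3)
      by (cases "col a = 0"; cases "col b = 0"; cases "x \<in> A"; cases "b \<in> A"; cases "col x = 0") simp_all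
  qed
  have kept: "col' x = col x" if "x \<le> n" "cl x \<noteq> cl b" for x
    using col'[OF that(1)] that(2) by simp
  have "(col' x = 0 \<longleftrightarrow> x \<in> A) \<longleftrightarrow> (col' y = 0 \<longleftrightarrow> y \<in> A)"
    if x: "x \<le> n" and y: "y \<le> n" and eq: "cl' x = cl' y" for x y
  proof (cases "cl x = cl b"; cases "cl y = cl b")
    assume c: "cl x = cl b" "cl y = cl b"
    show ?thesis using moved[OF x c(1)] moved[OF y c(2)] by simp
  next
    assume c: "cl x = cl b" "cl y \<noteq> cl b"
    then have "cl a = cl y" using eq cl'[OF x] cl'[OF y] by simp
    then show ?thesis using moved[OF x c(1)] kept[OF y c(2)] agree[OF ab(1) y] by simp
  next
    assume c: "cl x \<noteq> cl b" "cl y = cl b"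
    then have "cl x = cl a" using eq cl'[OF x] cl'[OF y] by simp
    then show ?thesis using moved[OF y c(2)] kept[OF x c(1)] agree[OF x ab(1)] by simp
  next
    assume c: "cl x \<noteq> cl b" "cl y \<noteq> cl b"
    then have "cl x = cl y" using eq cl'[OF x] cl'[OF y] by simp
    then show ?thesis using kept[OF x c(1)] kept[OF y c(2)] agree[OF x y] by simp
  qed
  moreover have "col' x \<le> 1" if "x \<le> n" for x using col'[OF that] le[OF that] by auto
  ultimately show ?thesis unfolding same_parity_def by (intro conjI allI impI)
qed

section \<open>The graph as program input, and correctness of the two-colouring\<close>

locale graph_input =
  fixes G :: ugraph and es :: "(nat \<times> nat) list"
  assumes simple: "simple_graph G" and edge_list: "edge_list G es"
begin

text \<open>The summand 2 puts both the number of edges and \<open>n + 1\<close> strictly below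
  \<open>X\<close>, as \<open>wp_For\<close> demands of its iteration counts.\<close>

definition X :: nat where
  "X = graph_size G + 2"

lemma length_es: "length es = card (edges G)"
  using edge_list distinct_card[of "map (\<lambda>(u, v). {u, v}) es"] by (simp add: edge_list_def)

lemma bounds: "length es < X" "nverts G < X" "Suc (nverts G) < X"
  by (auto simp: X_def graph_size_def length_es)

definition reads_graph :: "state \<Rightarrow> bool" where
  "reads_graph s \<longleftrightarrow> s ''n'' 0 = nverts G \<and> s ''m'' 0 = length es \<and>
     (\<forall>j<length es. (s ''u'' j, s ''v'' j) = es ! j)"

lemma reads_graph_cong:
  "s' ''n'' = s ''n'' \<Longrightarrow> s' ''m'' = s ''m'' \<Longrightarrow> s' ''u'' = s ''u'' \<Longrightarrow> s' ''v'' = s ''v'' \<Longrightarrow>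
    reads_graph s \<Longrightarrow> reads_graph s'"
  by (simp add: reads_graph_def)

lemma reads_graphD:
  assumes "reads_graph s"
  shows "s ''n'' 0 = nverts G" "s ''m'' 0 = length es"
    and "\<And>j. j < length es \<Longrightarrow> {s ''u'' j, s ''v'' j} \<in> edges G"
    and "\<And>x y. {x, y} \<in> edges G \<Longrightarrow>
      \<exists>j<length es. s ''u'' j = x \<and> s ''v'' j = y \<or> s ''u'' j = y \<and> s ''v'' j = x"
proof -
  show "s ''n'' 0 = nverts G" "s ''m'' 0 = length es"
    using assms by (auto simp: reads_graph_def)
  have edges: "edges G = (\<lambda>(u, v). {u, v}) ` set es"
    using edge_list by (simp add: edge_list_def)
  have nth: "es ! j = (s ''u'' j, s ''v'' j)" if "j < length es" for j
    using assms that by (simp add: reads_graph_def)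
  show "{s ''u'' j, s ''v'' j} \<in> edges G" if "j < length es" for j
    using nth_mem[OF that] nth[OF that] by (force simp: edges)
  show "\<exists>j<length es. s ''u'' j = x \<and> s ''v'' j = y \<or> s ''u'' j = y \<and> s ''v'' j = x"
    if edge: "{x, y} \<in> edges G" for x y
  proof -
    obtain e where e: "{x, y} = (case e of (u, v) \<Rightarrow> {u, v})" "e \<in> set es"
      using edge[unfolded edges] by (rule imageE)
    obtain j where j: "j < length es" "e = es ! j" using e(2) by (metis in_set_conv_nth)
    have "{x, y} = {s ''u'' j, s ''v'' j}" using e(1) by (simp add: j(2) nth[OF j(1)])
    then have "s ''u'' j = x \<and> s ''v'' j = y \<or> s ''u'' j = y \<and> s ''v'' j = x"
      unfolding doubleton_eq_iff by metis
    then show ?thesis using j(1) by blast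
  qed
qed

lemma reads_input_state: "reads_graph (input_state q G es)"
  by (auto simp: reads_graph_def input_state_def scalar_def array_of_def)

lemma edge_le:
  assumes "{x, y} \<in> edges G"
  shows "x \<le> nverts G" "y \<le> nverts G" "x \<noteq> 0" "y \<noteq> 0"
  using simple_graph_edge[OF simple assms] by (auto simp: verts_def)

text \<open>Numerals such as 60 and 100 in this and later time bounds are rounded-up costs of
  loop-free pieces.\<close>

lemma wp_relabel:
  assumes "reads_graph s"
  shows "wp (For ''w'' n_plus_1 relabel) (X * 100)
    (\<lambda>s'. \<forall>x\<le>nverts G.
       s' ''comp'' x = (if s ''comp'' x = s ''old'' 0 then s ''new'' 0 else s ''comp'' x) \<and>
       s' ''col'' x = (if s ''comp'' x = s ''old'' 0 \<and> 0 < s ''flip'' 0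
         then 1 - s ''col'' x else s ''col'' x)) s"
proof (rule wp_For[where h = "Suc (nverts G)" and T = 60 and I = "\<lambda>k s'.
    s' ''comp'' = (\<lambda>x. if x < k \<and> s ''comp'' x = s ''old'' 0 then s ''new'' 0 else s ''comp'' x) \<and>
    s' ''col'' = (\<lambda>x. if x < k \<and> s ''comp'' x = s ''old'' 0 \<and> 0 < s ''flip'' 0
         then 1 - s ''col'' x else s ''col'' x)"], goal_cases)
  case (2 k s')
  then have "s' ''old'' = s ''old''" "s' ''new'' = s ''new''" "s' ''flip'' = s ''flip''" by simp_all
  with 2(2,3) show ?case
    by (intro wp_exec) (auto simp: relabel_def less_Suc_eq fun_eq_iff)
next
  case (3 s')
  then show ?case using reads_graphD(1)[OF assms] by simp
qed (auto simp: bounds)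

text \<open>The last conjunct says that classes only grow; it keeps the endpoints of earlier edges
  together while later edges are merged.\<close>

lemma wp_merge_edge:
  assumes inp: "reads_graph s" and sp: "same_parity (nverts G) A (s ''comp'') (s ''col'')"
    and A: "\<And>x y. {x, y} \<in> edges G \<Longrightarrow> x \<in> A \<longleftrightarrow> y \<notin> A"
    and j: "s ''j'' 0 = j" "j < length es"
  shows "wp merge_edge (100 + X * 100)
    (\<lambda>s'. same_parity (nverts G) A (s' ''comp'') (s' ''col'') \<and>
       s' ''comp'' (s ''u'' j) = s' ''comp'' (s ''v'' j) \<and>
       (\<forall>x\<le>nverts G. \<forall>y\<le>nverts G. s ''comp'' x = s ''comp'' y \<longrightarrow> s' ''comp'' x = s' ''comp'' y)) s"
  unfolding merge_edge_def
proof (rule wp_Seq[OF wp_exec, where ?T1.0 = 100 and ?T2.0 = "X * 100"], goal_cases)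
  case 2
  let ?u = "s ''u'' j" and ?v = "s ''v'' j"
  define s1 where "s1 = s(''new'' := (s ''new'')(0 := s ''comp'' ?u), ''old'' := (s ''old'')(0 := s ''comp'' ?v),
    ''flip'' := (s ''flip'')(0 := if s ''col'' ?u = s ''col'' ?v then 1 else 0))"
  have e: "{?u, ?v} \<in> edges G" using reads_graphD(3)[OF inp j(2)] .
  have "reads_graph s1"
    by (rule reads_graph_cong[OF _ _ _ _ inp]) (simp_all add: s1_def)
  then have "wp (For ''w'' n_plus_1 relabel) (X * 100)
    (\<lambda>s'. same_parity (nverts G) A (s' ''comp'') (s' ''col'') \<and>
       s' ''comp'' ?u = s' ''comp'' ?v \<and>
       (\<forall>x\<le>nverts G. \<forall>y\<le>nverts G. s ''comp'' x = s ''comp'' y \<longrightarrow> s' ''comp'' x = s' ''comp'' y)) s1"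
  proof (rule wp_mono[OF wp_relabel], goal_cases)
    case (1 s')
    then have *: "s' ''comp'' x = (if s ''comp'' x = s ''comp'' ?v then s ''comp'' ?u else s ''comp'' x)"
      "s' ''col'' x = (if s ''comp'' x = s ''comp'' ?v \<and> s ''col'' ?u = s ''col'' ?v
         then 1 - s ''col'' x else s ''col'' x)" if "x \<le> nverts G" for x
      using that by (auto simp: s1_def)
    show ?case
      using same_parity_merge[OF sp edge_le(1,2)[OF e] A[OF e] *] edge_le(1,2)[OF e] * by simp
  qed
  also have "s1 = exec (Set ''new'' (Cell ''comp'' (Cell ''u'' (Var ''j''))) ;;
      Set ''old'' (Cell ''comp'' (Cell ''v'' (Var ''j''))) ;;
      If (Eq (Cell ''col'' (Cell ''u'' (Var ''j''))) (Cell ''col'' (Cell ''v'' (Var ''j''))))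
        (Set ''flip'' (Num 1)) (Set ''flip'' (Num 0))) s"
    using j(1) by (auto simp: s1_def fun_eq_iff)
  finally show ?case .
qed simp_all

lemma wp_two_colour:
  assumes inp: "reads_graph s" and col0: "s ''col'' = (\<lambda>_. 0)"
    and A: "\<And>x y. {x, y} \<in> edges G \<Longrightarrow> x \<in> A \<longleftrightarrow> y \<notin> A"
  shows "wp two_colour (X * 100 + X * (200 + X * 100))
    (\<lambda>s'. \<forall>x y. {x, y} \<in> edges G \<longrightarrow> (s' ''col'' x = 0 \<longleftrightarrow> s' ''col'' y \<noteq> 0)) s"
  unfolding two_colour_def
proof (rule wp_Seq)
  let ?Q = "\<lambda>s'. \<forall>x y. {x, y} \<in> edges G \<longrightarrow> (s' ''col'' x = 0 \<longleftrightarrow> s' ''col'' y \<noteq> 0)"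
  show "wp (For ''w'' n_plus_1 (Assign ''comp'' (Var ''w'') (Var ''w''))) (X * 100)
      (wp (For ''j'' (Var ''m'') merge_edge) (X * (200 + X * 100)) ?Q) s"
  proof (rule wp_For[where h = "Suc (nverts G)" and T = 60 and
        I = "\<lambda>k s'. \<forall>x<k. s' ''comp'' x = x"], goal_cases)
    case (2 k s')
    then show ?case by (intro wp_exec) auto
  next
    case (3 s')
    then show ?case using reads_graphD(1)[OF inp] by simp
  next
    case (4 s')
    then have "reads_graph s'" "s' ''col'' = (\<lambda>_. 0)"
      using reads_graph_cong[OF _ _ _ _ inp] col0 by simp_all
    \<comment> \<open>All classes are singletons at this point, so any 0/1 colouring would
      do.\<close>
    moreover have "same_parity (nverts G) A (s' ''comp'') (\<lambda>_. 0)"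
      using 4(1) by (simp add: same_parity_def)
    ultimately show ?case
    proof (intro wp_For[where h = "length es" and T = "100 + X * 100" and s = s' and I = "\<lambda>k s''.
        same_parity (nverts G) A (s'' ''comp'') (s'' ''col'') \<and>
        (\<forall>j<k. s'' ''comp'' (s'' ''u'' j) = s'' ''comp'' (s'' ''v'' j))"], goal_cases)
      case (2 k t)
      have inv: "\<And>j. j < k \<Longrightarrow> t ''comp'' (t ''u'' j) = t ''comp'' (t ''v'' j)" and k: "t ''j'' 0 = k"
        using 2(5,6) by simp_all
      have inp': "reads_graph t" by (rule reads_graph_cong[OF _ _ _ _ 2(1)]) (use 2(7) in simp_all)
      have le: "t ''u'' j \<le> nverts G" "t ''v'' j \<le> nverts G" if "j < k" for j
        using edge_le[OF reads_graphD(3)[OF inp', of j]] that 2(4) by auto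
      have "wp merge_edge (100 + X * 100)
        (\<lambda>s'. same_parity (nverts G) A (s' ''comp'') (s' ''col'') \<and>
           s' ''comp'' (t ''u'' k) = s' ''comp'' (t ''v'' k) \<and>
           (\<forall>x\<le>nverts G. \<forall>y\<le>nverts G. t ''comp'' x = t ''comp'' y \<longrightarrow> s' ''comp'' x = s' ''comp'' y)) t"
        by (rule wp_merge_edge[OF inp' _ A]) (use 2 in auto)
      then show ?case
      proof (rule wp_conseq, goal_cases)
        case (2 s')
        from 2(2)[of "''u''"] 2(2)[of "''v''"] 2(2)[of "''j''"]
        have "s' ''u'' = t ''u''" "s' ''v'' = t ''v''" "s' ''j'' = t ''j''" by simp_all
        moreover have "s' ''comp'' (t ''u'' j) = s' ''comp'' (t ''v'' j)" if "j < Suc k" for j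
        proof (cases "j = k")
          case False
          then have "j < k" using that by simp
          then show ?thesis using 2(1) inv le by blast
        qed (use 2(1) in simp)
        ultimately show ?case using 2(1) k by simp
      qed simp
    next
      case (4 t)
      have inp': "reads_graph t" by (rule reads_graph_cong[OF _ _ _ _ 4(1)]) (use 4(5) in simp_all)
      show ?case
      proof (intro allI impI)
        fix x y assume e: "{x, y} \<in> edges G"
        \<comment> \<open>All edges have been merged, so the endpoints share a class, on which the
          colouring is \<open>A\<close> or its complement.\<close>
        then have "t ''comp'' x = t ''comp'' y"
          using reads_graphD(4)[OF inp' e] 4(4) by metis
        then have "(t ''col'' x = 0 \<longleftrightarrow> x \<in> A) \<longleftrightarrow> (t ''col'' y = 0 \<longleftrightarrow> y \<in> A)"
          using 4(4) edge_le[OF e] by (intro same_parityD(2)[where cl = "t ''comp''"]) auto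
        then show "t ''col'' x = 0 \<longleftrightarrow> t ''col'' y \<noteq> 0" using A[OF e]
          by (cases "y \<in> A"; cases "t ''col'' y = 0") simp_all
      qed
    qed (auto simp: bounds reads_graphD)
  qed (auto simp: bounds)
qed simp

section \<open>Correctness and running time of the auction\<close>

text \<open>While \<open>best\<close> is 0 its price is \<open>L\<close>, so the single inequality
  of the invariant also expresses that no scanned neighbour is cheaper than the cap.\<close>

lemma wp_find_cheapest:
  assumes inp: "reads_graph s" and L: "s ''price'' 0 = L" "\<And>b. s ''price'' b \<le> L"
  shows "wp find_cheapest (10 + X * 100)
    (\<lambda>s'. cheapest G L (s ''cur'' 0) (s ''price'') (s' ''best'' 0)) s"
  unfolding find_cheapest_def
proof (rule wp_Seq[OF wp_exec, where ?T1.0 = 10 and ?T2.0 = "X * 100"], goal_cases)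
  case 2
  let ?s = "exec (Set ''best'' (Num 0)) s"
  let ?cur = "s ''cur'' 0" and ?p = "s ''price''"
  show ?case
  proof (rule wp_For[where h = "length es" and T = 70 and I = "\<lambda>k s'.
      (s' ''best'' 0 = 0 \<or> {s' ''best'' 0, ?cur} \<in> edges G \<and> ?p (s' ''best'' 0) < L) \<and>
      (\<forall>j<k. (s ''u'' j = ?cur \<longrightarrow> ?p (s' ''best'' 0) \<le> ?p (s ''v'' j)) \<and>
        (s ''v'' j = ?cur \<longrightarrow> ?p (s' ''best'' 0) \<le> ?p (s ''u'' j)))"], goal_cases)
    case 1
    then show ?case by simp
  next
    case (2 k s')
    have [simp]: "s' ''u'' = s ''u''" "s' ''v'' = s ''v''" "s' ''cur'' = s ''cur''"
      "s' ''price'' = s ''price''"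
      using 2(4) by simp_all
    have e: "{s ''u'' k, s ''v'' k} \<in> edges G" "{s ''v'' k, s ''u'' k} \<in> edges G"
      using reads_graphD(3)[OF inp 2(1)] by (simp_all add: insert_commute)
    have ne: "s ''u'' k \<noteq> s ''v'' k"
      using simple_graph_edge(3)[OF simple e(1)] .
    note pL = L(2)[of "s' ''best'' 0"]
    show ?case
    proof (rule wp_exec, goal_cases)
      case 2
      show ?case
        using \<open>s' ''j'' 0 = k\<close> \<open>_ \<and> (\<forall>j<k. _ j)\<close> ne e pL L(1)
        by (auto simp: inspect_def less_Suc_eq)
    qed (simp_all add: inspect_def)
  next
    case (3 s')
    then have "s' ''m'' = s ''m''" by simp
    then show ?case using reads_graphD(2)[OF inp] by simp
  next
    case (4 s')
    have "?p (s' ''best'' 0) \<le> ?p b" if b: "{b, ?cur} \<in> edges G" for b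
      using reads_graphD(4)[OF inp b] 4(1) by metis
    then show ?case using 4(1) L(1) unfolding cheapest_def by auto
  qed (simp_all add: bounds)
qed simp_all

text \<open>The exact new prices are recorded for the termination measure; the invariant alone would
  not show progress.\<close>

lemma wp_bid:
  assumes auction: "auction G A L a (s ''cur'' 0) (s ''mate'') (s ''price'')"
    and best: "cheapest G L (s ''cur'' 0) (s ''price'') (s ''best'' 0)"
    and cur: "s ''cur'' 0 \<noteq> 0"
  shows "wp bid 50 (\<lambda>s'. auction G A L a (s' ''cur'' 0) (s' ''mate'') (s' ''price'') \<and>
    (if s ''best'' 0 = 0 then s' ''cur'' 0 = 0 \<and> s' ''price'' = s ''price''
     else s' ''price'' = (s ''price'')(s ''best'' 0 := Suc (s ''price'' (s ''best'' 0))))) s"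
proof (rule wp_exec, goal_cases)
  case 2
  show ?case
  proof (cases "s ''best'' 0 = 0")
    case True
    then show ?thesis using auction_give_up[OF auction] best by (simp add: bid_def)
  next
    case False
    then show ?thesis using auction_bid[OF auction best False cur]
      by (simp add: bid_def fun_upd_def)
  qed
qed (simp_all add: bid_def)

text \<open>A potential: the price increases still possible, plus one for an active bidder. A bid
  lowers the sum, and giving up removes the one.\<close>

definition slack_sum :: "nat \<Rightarrow> state \<Rightarrow> nat" where
  "slack_sum L s = (if s ''cur'' 0 = 0 then 0 else 1) + (\<Sum>b\<in>verts G. L - s ''price'' b)"

lemma wp_run_bidder:
  assumes inp: "reads_graph s"
    and auction: "auction G A (Suc (nverts G)) a 0 (s ''mate'') (s ''price'')"
    and A: "A = {x \<in> verts G. s ''col'' x = 0}" and a: "s ''a'' 0 = a" "a \<le> nverts G"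
  shows "wp run_bidder (30 + X * X * (100 + X * 100))
    (\<lambda>s'. auction G A (Suc (nverts G)) (Suc a) 0 (s' ''mate'') (s' ''price'')) s"
  unfolding run_bidder_def
proof (rule wp_Seq[OF wp_exec, where ?T1.0 = 30 and ?T2.0 = "X * X * (100 + X * 100)"], goal_cases)
  case 2
  let ?L = "Suc (nverts G)"
  let ?s = "exec start_bidder s"
  let ?I = "\<lambda>s'. reads_graph s' \<and> auction G A ?L (Suc a) (s' ''cur'' 0) (s' ''mate'') (s' ''price'')"
  have "0 \<notin> A" using A by (auto simp: verts_def)
  moreover have "?s ''cur'' 0 = (if a \<in> A then a else 0)"
    using a A by (auto simp: start_bidder_def verts_def)
  moreover have same: "?s ''mate'' = s ''mate''" "?s ''price'' = s ''price''" "?s ''n'' = s ''n''"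
    "?s ''m'' = s ''m''" "?s ''u'' = s ''u''" "?s ''v'' = s ''v''"
    by (simp_all add: start_bidder_def)
  ultimately have init: "?I ?s"
    using auction_start[OF auction] reads_graph_cong[OF same(3-6) inp] by simp
  \<comment> \<open>The full price range, plus one, bounds the iterations; this budget is granted
    anew to each bidder instead of being shared over the auction.\<close>
  have "(\<Sum>b\<in>verts G. ?L - ?s ''price'' b) \<le> (\<Sum>b\<in>verts G. ?L)"
    by (rule sum_mono) simp
  also have "\<dots> = nverts G * ?L" by (simp add: verts_def)
  finally have "slack_sum ?L ?s \<le> 1 + nverts G * ?L" by (simp add: slack_sum_def)
  also have "\<dots> \<le> ?L * ?L" by simp
  also have "\<dots> < X * X" using bounds(3) by (intro mult_strict_mono) auto
  finally have small: "slack_sum ?L ?s < X * X" .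
  have "wp (While (Less (Num 0) (Var ''cur'')) (find_cheapest ;; bid)) (X * X * (100 + X * 100))
      (\<lambda>s'. ?I s' \<and> \<not> bval (Less (Num 0) (Var ''cur'')) s') ?s"
  proof (rule wp_While[where T = "10 + X * 100 + 50" and \<mu> = "slack_sum ?L" and I = ?I])
    show "?I ?s" by (fact init)
    fix t assume I: "?I t" and "bval (Less (Num 0) (Var ''cur'')) t"
    then have cur: "t ''cur'' 0 \<noteq> 0" by simp
    interpret auction G A ?L "Suc a" "t ''cur'' 0" "t ''mate''" "t ''price''" using I by simp
    have "wp find_cheapest (10 + X * 100)
        (\<lambda>s'. cheapest G ?L (t ''cur'' 0) (t ''price'') (s' ''best'' 0)) t"
      using I price_0 price_le by (intro wp_find_cheapest) auto
    then have "wp find_cheapest (10 + X * 100)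
        (wp bid 50 (\<lambda>s'. ?I s' \<and> slack_sum ?L s' < slack_sum ?L t)) t"
    proof (rule wp_conseq, goal_cases)
      case (2 t1)
      then have same: "t1 ''cur'' = t ''cur''" "t1 ''mate'' = t ''mate''" "t1 ''price'' = t ''price''"
        "t1 ''n'' = t ''n''" "t1 ''m'' = t ''m''" "t1 ''u'' = t ''u''" "t1 ''v'' = t ''v''"
        by simp_all
      have best: "cheapest G ?L (t ''cur'' 0) (t ''price'') (t1 ''best'' 0)"
        using 2 by simp
      have "wp bid 50 (\<lambda>s'. auction G A ?L (Suc a) (s' ''cur'' 0) (s' ''mate'') (s' ''price'') \<and>
        (if t1 ''best'' 0 = 0 then s' ''cur'' 0 = 0 \<and> s' ''price'' = t1 ''price''
         else s' ''price'' = (t1 ''price'')(t1 ''best'' 0 := Suc (t1 ''price'' (t1 ''best'' 0))))) t1"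
        using I best cur by (intro wp_bid) (simp_all add: same)
      then show ?case
      proof (rule wp_conseq, goal_cases)
        case (2 t2)
        then have "t2 ''n'' = t1 ''n''" "t2 ''m'' = t1 ''m''" "t2 ''u'' = t1 ''u''" "t2 ''v'' = t1 ''v''"
          by simp_all
        then have "reads_graph t2"
          using I by (intro reads_graph_cong[of t2 t]) (simp_all add: same)
        moreover have "slack_sum ?L t2 < slack_sum ?L t"
        proof (cases "t1 ''best'' 0 = 0")
          case True
          then show ?thesis using 2(1) cur by (simp add: slack_sum_def same)
        next
          case False
          let ?b = "t1 ''best'' 0"
          have price: "t2 ''price'' = (t ''price'')(?b := Suc (t ''price'' ?b))"
            using False 2(1) by (simp add: same)
          have b: "{?b, t ''cur'' 0} \<in> edges G" "t ''price'' ?b < ?L"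
            using best False by (simp_all add: cheapest_def)
          have "?b \<in> verts G" using simple_graph_edge(1)[OF simple b(1)] .
          then have "(\<Sum>b\<in>verts G. ?L - t2 ''price'' b) < (\<Sum>b\<in>verts G. ?L - t ''price'' b)"
            using b(2) by (intro sum_strict_mono_ex1 bexI[of _ ?b]) (auto simp: price)
          then show ?thesis using cur by (simp add: slack_sum_def)
        qed
        ultimately show ?case using 2(1) by blast
      qed simp
    qed simp
    then show "wp (find_cheapest ;; bid) (10 + X * 100 + 50)
        (\<lambda>s'. ?I s' \<and> slack_sum ?L s' < slack_sum ?L t) t"
      by (rule wp_Seq) simp
  qed (use small in simp_all)
  then show ?case by (rule wp_mono) auto
qed (simp_all add: start_bidder_def)

lemma wp_run_auction:
  assumes inp: "reads_graph s"
    and zero: "s ''mate'' = (\<lambda>_. 0)" "s ''price'' = (\<lambda>_. 0)"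
    and A: "A = {x \<in> verts G. s ''col'' x = 0}"
  shows "wp run_auction (20 + X * (60 + X * X * (100 + X * 100)))
    (\<lambda>s'. auction G A (Suc (nverts G)) (Suc (nverts G)) 0 (s' ''mate'') (s' ''price'')) s"
  unfolding run_auction_def
proof (rule wp_Seq[OF wp_exec, where ?T1.0 = 20 and ?T2.0 = "X * (60 + X * X * (100 + X * 100))"],
    goal_cases)
  case 2
  let ?L = "Suc (nverts G)"
  let ?s = "exec (Assign ''price'' (Num 0) n_plus_1) s"
  have price: "?s ''price'' = (\<lambda>b. if b = 0 then ?L else 0)"
    using zero reads_graphD(1)[OF inp] by (simp add: fun_eq_iff)
  have init: "auction G A ?L 0 0 (?s ''mate'') (?s ''price'')"
    unfolding price by unfold_locales (simp_all add: zero)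
  have inp': "reads_graph ?s" by (rule reads_graph_cong[OF _ _ _ _ inp]) simp_all
  show ?case
  proof (rule wp_For[where h = ?L and T = "30 + X * X * (100 + X * 100)" and
        I = "\<lambda>k s'. auction G A ?L k 0 (s' ''mate'') (s' ''price'')"], goal_cases)
    case (2 k t)
    have "reads_graph t" by (rule reads_graph_cong[OF _ _ _ _ inp']) (use 2(4) in simp_all)
    moreover have "t ''col'' = s ''col''" using 2(4)[of "''col''"] by simp
    ultimately have "wp run_bidder (30 + X * X * (100 + X * 100))
        (\<lambda>s'. auction G A ?L (Suc k) 0 (s' ''mate'') (s' ''price'')) t"
      using 2(1-3) A by (intro wp_run_bidder) auto
    then show ?case
      by (rule wp_conseq) (use 2(3) in simp_all)
  next
    case (3 t)
    then have "t ''n'' = ?s ''n''" by simp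
    then show ?case using reads_graphD(1)[OF inp'] by simp
  qed (use init bounds in simp_all)
qed simp_all

section \<open>Numbering the matched pairs\<close>

text \<open>The invariant after the right ends below \<open>c\<close>. Its third clause keeps
  vertices outside the handled pairs at 0, the mark for unmatched; its fourth becomes the
  surjectivity clause of \<open>pairing\<close>.\<close>

definition numbered :: "(nat \<Rightarrow> nat) \<Rightarrow> nat \<Rightarrow> nat \<Rightarrow> (nat \<Rightarrow> nat) \<Rightarrow> (nat \<Rightarrow> nat) \<Rightarrow> bool" where
  "numbered mate c k idx pt \<longleftrightarrow>
     k = card {b. b < c \<and> mate b \<noteq> 0} \<and>
     (\<forall>b<c. mate b \<noteq> 0 \<longrightarrow> pt b = mate b \<and> pt (mate b) = b \<and>
        idx b = idx (mate b) \<and> idx b \<in> {1..k}) \<and>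
     (\<forall>x. pt x \<noteq> 0 \<or> idx x \<noteq> 0 \<longrightarrow> (\<exists>b<c. mate b \<noteq> 0 \<and> (x = b \<or> x = mate b))) \<and>
     (\<forall>l\<in>{1..k}. \<exists>b<c. mate b \<noteq> 0 \<and> idx b = l)"

lemma numbered_skip:
  assumes "numbered mate c k idx pt" "mate c = 0"
  shows "numbered mate (Suc c) k idx pt"
proof -
  have "b < Suc c \<and> mate b \<noteq> 0 \<longleftrightarrow> b < c \<and> mate b \<noteq> 0" for b
    using assms(2) by (auto simp: less_Suc_eq)
  then have less_Suc: "(\<forall>b<Suc c. mate b \<noteq> 0 \<longrightarrow> P b) \<longleftrightarrow> (\<forall>b<c. mate b \<noteq> 0 \<longrightarrow> P b)"
    "(\<exists>b<Suc c. mate b \<noteq> 0 \<and> P b) \<longleftrightarrow> (\<exists>b<c. mate b \<noteq> 0 \<and> P b)"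
    "{b. b < Suc c \<and> mate b \<noteq> 0} = {b. b < c \<and> mate b \<noteq> 0}" for P
    by blast+
  show ?thesis using assms(1) unfolding numbered_def less_Suc .
qed

text \<open>Injectivity and \<open>bip\<close> ensure that the new pair is disjoint from all earlier
  ones, so the four updates overwrite nothing that the invariant relies on.\<close>

lemma numbered_step:
  assumes num: "numbered mate c k idx pt" and c: "mate c \<noteq> 0"
    and inj: "\<And>b b'. mate b \<noteq> 0 \<Longrightarrow> mate b = mate b' \<Longrightarrow> b = b'"
    and bip: "\<And>b b'. mate b \<noteq> 0 \<Longrightarrow> mate b' \<noteq> 0 \<Longrightarrow> b \<noteq> mate b'"
  shows "numbered mate (Suc c) (Suc k) (idx(c := Suc k, mate c := Suc k))
    (pt(c := mate c, mate c := c))"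
    (is "numbered _ _ _ ?idx ?pt")
proof -
  have k: "k = card {b. b < c \<and> mate b \<noteq> 0}"
    and 1: "\<And>b. b < c \<Longrightarrow> mate b \<noteq> 0 \<Longrightarrow> pt b = mate b \<and> pt (mate b) = b \<and>
        idx b = idx (mate b) \<and> idx b \<in> {1..k}"
    and 2: "\<And>x. pt x \<noteq> 0 \<or> idx x \<noteq> 0 \<Longrightarrow> \<exists>b<c. mate b \<noteq> 0 \<and> (x = b \<or> x = mate b)"
    and 3: "\<And>l. l \<in> {1..k} \<Longrightarrow> \<exists>b<c. mate b \<noteq> 0 \<and> idx b = l"
    using num unfolding numbered_def by blast+
  have other: "b \<noteq> c" "b \<noteq> mate c" "mate b \<noteq> c" "mate b \<noteq> mate c" if "b < c" "mate b \<noteq> 0" for b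
    using that bip[OF that(2) c] bip[OF c that(2)] inj[OF that(2), of c] by auto
  have cc: "c \<noteq> mate c" using bip[OF c c] .
  have "{b. b < Suc c \<and> mate b \<noteq> 0} = insert c {b. b < c \<and> mate b \<noteq> 0}"
    using c by (auto simp: less_Suc_eq)
  then have "Suc k = card {b. b < Suc c \<and> mate b \<noteq> 0}" using k by simp
  moreover have "?pt b = mate b \<and> ?pt (mate b) = b \<and> ?idx b = ?idx (mate b) \<and> ?idx b \<in> {1..Suc k}"
    if "b < Suc c" "mate b \<noteq> 0" for b
  proof (cases "b = c")
    case True
    then show ?thesis using cc by simp
  next
    case False
    then have "b < c" using that(1) by simp
    then show ?thesis using 1[OF _ that(2)] other[OF _ that(2)] by simp
  qed
  moreover have "\<exists>b<Suc c. mate b \<noteq> 0 \<and> (x = b \<or> x = mate b)" if "?pt x \<noteq> 0 \<or> ?idx x \<noteq> 0" for x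
  proof (cases "x = c \<or> x = mate c")
    case True
    then show ?thesis using c by blast
  next
    case False
    then have "pt x \<noteq> 0 \<or> idx x \<noteq> 0" using that by simp
    then show ?thesis using 2[of x] less_SucI by blast
  qed
  moreover have "\<exists>b<Suc c. mate b \<noteq> 0 \<and> ?idx b = l" if l: "l \<in> {1..Suc k}" for l
  proof (cases "l = Suc k")
    case True
    then show ?thesis using c by (intro exI[of _ c]) simp
  next
    case False
    then obtain b where "b < c" "mate b \<noteq> 0" "idx b = l" using l 3[of l] by auto
    then show ?thesis using other[of b] by (intro exI[of _ b]) simp
  qed
  ultimately show ?thesis unfolding numbered_def by blast
qed

lemma numbered_pairing:
  assumes num: "numbered mate (Suc (nverts G)) k idx pt"
    and mate: "\<And>b. mate b \<noteq> 0 \<Longrightarrow> {b, mate b} \<in> edges G"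
  shows "pairing G k idx pt" "k = card {b. mate b \<noteq> 0}"
proof -
  have le: "b < Suc (nverts G)" "b \<in> verts G" "mate b \<in> verts G" if "mate b \<noteq> 0" for b
    using edge_le[OF mate[OF that]] simple_graph_edge[OF simple mate[OF that]] by auto
  then have "{b. b < Suc (nverts G) \<and> mate b \<noteq> 0} = {b. mate b \<noteq> 0}" by blast
  then show "k = card {b. mate b \<noteq> 0}" using num by (simp add: numbered_def)
  have 1: "pt b = mate b" "pt (mate b) = b" "idx b = idx (mate b)" "idx b \<in> {1..k}"
    if "mate b \<noteq> 0" for b
    using num le(1)[OF that] that unfolding numbered_def by blast+
  have 2: "\<exists>b. mate b \<noteq> 0 \<and> (x = b \<or> x = mate b)" if "pt x \<noteq> 0 \<or> idx x \<noteq> 0" for x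
    using num that unfolding numbered_def by blast
  \<comment> \<open>The entry \<open>pt (mate b) = b\<close> must not be mistaken for the mark of an
    unmatched vertex.\<close>
  have nz: "b \<noteq> 0" if "mate b \<noteq> 0" for b using edge_le(3)[OF mate[OF that]] .
  have "if pt x = 0 then idx x = 0 else pt x \<in> nbrs G x \<and> idx (pt x) = idx x \<and> idx x \<in> {1..k}" for x
  proof (cases "\<exists>b. mate b \<noteq> 0 \<and> (x = b \<or> x = mate b)")
    case True
    then obtain b where b: "mate b \<noteq> 0" "x = b \<or> x = mate b" by blast
    have "b \<in> nbrs G (mate b)" "mate b \<in> nbrs G b"
      using mate[OF b(1)] le[OF b(1)] by (simp_all add: nbrs_def insert_commute)
    then show ?thesis using b 1[OF b(1)] nz[OF b(1)] by auto
  next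
    case False
    then have "pt x = 0 \<and> idx x = 0" using 2[of x] by blast
    then show ?thesis by simp
  qed
  moreover have "{1..k} \<subseteq> idx ` verts G"
  proof
    fix l assume "l \<in> {1..k}"
    then obtain b where "mate b \<noteq> 0" "idx b = l" using num unfolding numbered_def by blast
    then show "l \<in> idx ` verts G" using le(2) by blast
  qed
  ultimately show "pairing G k idx pt" unfolding pairing_def by blast
qed

lemma wp_number_pairs:
  assumes inp: "reads_graph s"
    and zero: "s ''k'' 0 = 0" "s ''idx'' = (\<lambda>_. 0)" "s ''pt'' = (\<lambda>_. 0)"
    and inj: "\<And>b b'. s ''mate'' b \<noteq> 0 \<Longrightarrow> s ''mate'' b = s ''mate'' b' \<Longrightarrow> b = b'"
    and bip: "\<And>b b'. s ''mate'' b \<noteq> 0 \<Longrightarrow> s ''mate'' b' \<noteq> 0 \<Longrightarrow> b \<noteq> s ''mate'' b'"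
  shows "wp number_pairs (X * 100)
    (\<lambda>s'. numbered (s ''mate'') (Suc (nverts G)) (s' ''k'' 0) (s' ''idx'') (s' ''pt'')) s"
  unfolding number_pairs_def
proof (rule wp_For[where h = "Suc (nverts G)" and T = 70 and
      I = "\<lambda>c s'. numbered (s ''mate'') c (s' ''k'' 0) (s' ''idx'') (s' ''pt'')"], goal_cases)
  case 1
  show ?case by (simp add: numbered_def zero)
next
  case (2 c t)
  have [simp]: "t ''mate'' = s ''mate''" using 2(4) by simp
  show ?case
  proof (rule wp_exec, goal_cases)
    case 2
    show ?case
    proof (cases "s ''mate'' c = 0")
      case True
      then show ?thesis
        using numbered_skip[OF \<open>numbered _ _ _ _ _\<close>] \<open>t ''b'' 0 = c\<close> by (simp add: number_pair_def)
    next
      case False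
      then show ?thesis
        using numbered_step[OF \<open>numbered _ _ _ _ _\<close> False inj bip] \<open>t ''b'' 0 = c\<close>
        by (simp add: number_pair_def fun_upd_def cong: if_cong)
    qed
  qed (simp_all add: number_pair_def)
next
  case (3 t)
  then have "t ''n'' = s ''n''" by simp
  then show ?case using reads_graphD(1)[OF inp] by simp
qed (use bounds in simp_all)

section \<open>Writing out the description\<close>

lemma outputs_snoc:
  "outputs s (xs @ [y]) \<longleftrightarrow> s ''outlen'' 0 = Suc (length xs) \<and>
     (\<forall>i<length xs. s ''out'' i = xs ! i) \<and> s ''out'' (length xs) = y"
  by (auto simp: outputs_def less_Suc_eq nth_append)

lemma outputs_emit:
  "outputs s xs \<Longrightarrow> aval a s = y \<Longrightarrow> outputs (exec (emit a) s) (xs @ [y])"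
  unfolding outputs_snoc by (simp add: outputs_def emit_def)

text \<open>The array \<open>x\<close> is read again after the token 3 has been written, so
  \<open>emit\<close> must not touch it.\<close>

lemma outputs_emit_var:
  assumes out: "outputs s xs" and x: "x \<noteq> ''out''" "x \<noteq> ''outlen''"
  shows "outputs (exec (emit_var x) s) (xs @ tokens (var_or_zero (s x (Suc (s ''i'' 0)))))"
proof (cases "s x (Suc (s ''i'' 0)) = 0")
  case True
  then show ?thesis
    using outputs_emit[OF out, of "Num 1" 1] by (simp add: emit_var_def tokens_var_or_zero)
next
  case False
  let ?e = "Cell x (Add (Var ''i'') (Num 1))"
  have "aval ?e (exec (emit (Num 3)) s) = s x (Suc (s ''i'' 0))"
    using x by (simp add: emit_def)
  then have "outputs (exec (emit ?e) (exec (emit (Num 3)) s))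
      ((xs @ [3]) @ [s x (Suc (s ''i'' 0))])"
    by (intro outputs_emit out) auto
  then show ?thesis using False by (simp add: emit_var_def tokens_var_or_zero)
qed

lemma wp_emit_vars:
  assumes inp: "reads_graph s" and out: "outputs s xs" and x: "x \<notin> {''i'', ''out'', ''outlen''}"
  shows "wp (emit_vars x) (X * 100) (\<lambda>s'.
    outputs s' (xs @ concat (map (\<lambda>i. tokens (var_or_zero (s x i))) [1..<Suc (nverts G)]))) s"
  unfolding emit_vars_def
proof (rule wp_For[where h = "nverts G" and T = 70 and I = "\<lambda>c s'.
      outputs s' (xs @ concat (map (\<lambda>i. tokens (var_or_zero (s x i))) [1..<Suc c]))"], goal_cases)
  case 1
  show ?case using out by (simp add: outputs_def)
next
  case (2 c t)
  have same: "t x = s x" using 2(4)[of x] x by simp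
  have i: "exec (emit_var x) t ''i'' 0 = c" using 2(3) by (simp add: emit_var_def emit_def)
  have "outputs (exec (emit_var x) t)
      (xs @ concat (map (\<lambda>i. tokens (var_or_zero (s x i))) [1..<Suc (Suc c)]))"
    using outputs_emit_var[OF 2(2), of x] x same 2(3) by simp
  then show ?case
    using i by (intro wp_exec) (simp_all add: outputs_def emit_var_def emit_def)
next
  case (3 t)
  then have "t ''n'' = s ''n''" by simp
  then show ?case using reads_graphD(1)[OF inp] by simp
qed (use bounds in simp_all)

lemma wp_emit_pairing:
  assumes inp: "reads_graph s" and out: "s ''outlen'' 0 = 0"
  shows "wp (emit (Var ''k'') ;; emit_vars ''idx'' ;; emit_vars ''pt'') (20 + (X * 100 + X * 100))
    (\<lambda>s'. outputs s' (desc_tokens G (pairing_code (s ''k'' 0) (s ''idx'') (s ''pt'')))) s"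
proof (rule wp_Seq[OF wp_exec, where ?T1.0 = 20 and ?T2.0 = "X * 100 + X * 100"], goal_cases)
  case 2
  let ?list = "\<lambda>f :: nat \<Rightarrow> nat. concat (map (\<lambda>i. tokens (var_or_zero (f i))) [1..<Suc (nverts G)])"
  let ?s = "exec (emit (Var ''k'')) s"
  have same: "?s ''n'' = s ''n''" "?s ''m'' = s ''m''" "?s ''u'' = s ''u''" "?s ''v'' = s ''v''"
    "?s ''idx'' = s ''idx''" "?s ''pt'' = s ''pt''"
    by (simp_all add: emit_def)
  have inp': "reads_graph ?s" by (rule reads_graph_cong[OF same(1-4) inp])
  have "outputs s []" using out by (simp add: outputs_def)
  then have "outputs ?s ([] @ [s ''k'' 0])" by (rule outputs_emit) simp
  then have "wp (emit_vars ''idx'') (X * 100)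
      (\<lambda>s'. outputs s' (([] @ [s ''k'' 0]) @ ?list (?s ''idx''))) ?s"
    by (intro wp_emit_vars inp') auto
  then have "wp (emit_vars ''idx'') (X * 100) (wp (emit_vars ''pt'') (X * 100)
      (\<lambda>s'. outputs s' (desc_tokens G (pairing_code (s ''k'' 0) (s ''idx'') (s ''pt''))))) ?s"
  proof (rule wp_conseq, goal_cases)
    case (2 t)
    then have same': "t ''n'' = ?s ''n''" "t ''m'' = ?s ''m''" "t ''u'' = ?s ''u''" "t ''v'' = ?s ''v''"
      "t ''pt'' = ?s ''pt''"
      by simp_all
    have "reads_graph t" by (rule reads_graph_cong[OF same'(1-4) inp'])
    with 2(1) have "wp (emit_vars ''pt'') (X * 100)
        (\<lambda>s'. outputs s' ((([] @ [s ''k'' 0]) @ ?list (?s ''idx'')) @ ?list (t ''pt''))) t"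
      by (intro wp_emit_vars) auto
    then show ?case
      by (simp only: same' same desc_tokens_pairing_code append_assoc append_Cons append_Nil)
  qed simp
  then show ?case by (rule wp_Seq) simp
qed (simp_all add: emit_def)

section \<open>Assembly of the program and the final theorem\<close>

text \<open>The nesting follows the uses of \<open>wp_Seq\<close>, so the time polynomial arises by
  substituting a linear polynomial for \<open>X\<close>.\<close>

definition program_time :: nat where
  "program_time =
     (X * 100 + X * (200 + X * 100)) + (20 + X * (60 + X * X * (100 + X * 100)) +
       (X * 100 + (20 + (X * 100 + X * 100))))"

definition optimal_output :: "state \<Rightarrow> bool" where
  "optimal_output s \<longleftrightarrow> (\<exists>k idx pt M S.
     outputs s (desc_tokens G (pairing_code k idx pt)) \<and> pairing G k idx pt \<and>
     matching G M \<and> card M = k \<and> vertex_cover G S \<and> card S = k)"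

lemma wp_matching_code_program:
  assumes bip: "bipartite G"
  shows "wp matching_code_program program_time optimal_output (input_state q G es)"
  unfolding matching_code_program_def program_time_def
proof (rule wp_Seq)
  let ?s = "input_state q G es"
  let ?Q = optimal_output
  have zero: "?s x = (\<lambda>_. 0)" if "x \<notin> {''q'', ''n'', ''m'', ''u'', ''v''}" for x
    using that by (simp add: input_state_def)
  obtain A0 B0 where AB: "A0 \<inter> B0 = {}" "\<And>e. e \<in> edges G \<Longrightarrow> \<exists>a\<in>A0. \<exists>b\<in>B0. e = {a, b}"
    using bip unfolding bipartite_def by metis
  have A0: "x \<in> A0 \<longleftrightarrow> y \<notin> A0" if "{x, y} \<in> edges G" for x y
    using AB(2)[OF that] AB(1) by (auto simp: doubleton_eq_iff)
  have "wp two_colour (X * 100 + X * (200 + X * 100))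
      (\<lambda>s'. \<forall>x y. {x, y} \<in> edges G \<longrightarrow> (s' ''col'' x = 0 \<longleftrightarrow> s' ''col'' y \<noteq> 0)) ?s"
    by (rule wp_two_colour[OF reads_input_state _ A0]) (simp_all add: zero)
  then show "wp two_colour (X * 100 + X * (200 + X * 100))
      (wp (run_auction ;; number_pairs ;; emit (Var ''k'') ;; emit_vars ''idx'' ;; emit_vars ''pt'')
        (20 + X * (60 + X * X * (100 + X * 100)) + (X * 100 + (20 + (X * 100 + X * 100)))) ?Q) ?s"
  proof (rule wp_conseq, goal_cases)
    case (2 s1)
    have inp1: "reads_graph s1" by (rule reads_graph_cong[OF _ _ _ _ reads_input_state]) (use 2(2) in simp_all)
    \<comment> \<open>From here on the sides are those that the program computed; they may differ
      from \<open>A0\<close>.\<close>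
    define A where "A = {x \<in> verts G. s1 ''col'' x = 0}"
    have A: "(x \<in> A) \<noteq> (y \<in> A)" if "{x, y} \<in> edges G" for x y
      using 2(1) that simple_graph_edge[OF simple that] by (auto simp: A_def)
    have "wp run_auction (20 + X * (60 + X * X * (100 + X * 100)))
        (\<lambda>s'. auction G A (Suc (nverts G)) (Suc (nverts G)) 0 (s' ''mate'') (s' ''price'')) s1"
      by (rule wp_run_auction[OF inp1 _ _ A_def]) (simp_all add: 2(2) zero)
    then have "wp run_auction (20 + X * (60 + X * X * (100 + X * 100)))
        (wp (number_pairs ;; emit (Var ''k'') ;; emit_vars ''idx'' ;; emit_vars ''pt'')
          (X * 100 + (20 + (X * 100 + X * 100))) ?Q) s1"
    proof (rule wp_conseq, goal_cases)
      case (2 s2)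
      have inp2: "reads_graph s2" by (rule reads_graph_cong[OF _ _ _ _ inp1]) (use 2(2) in simp_all)
      interpret auction G A "Suc (nverts G)" "Suc (nverts G)" 0 "s2 ''mate''" "s2 ''price''"
        using 2(1) .
      obtain M where M: "matching G M" "card M = card {b. s2 ''mate'' b \<noteq> 0}"
        using auction_matching[OF A 2(1)] by blast
      obtain S where S: "vertex_cover G S" "card S = card {b. s2 ''mate'' b \<noteq> 0}"
        using auction_vertex_cover[OF simple _ A 2(1)] by (auto simp: A_def)
      have "wp number_pairs (X * 100) (\<lambda>s'. numbered (s2 ''mate'') (Suc (nverts G))
          (s' ''k'' 0) (s' ''idx'') (s' ''pt'')) s2"
      proof (rule wp_number_pairs[OF inp2])
        show "s2 ''k'' 0 = 0" "s2 ''idx'' = (\<lambda>_. 0)" "s2 ''pt'' = (\<lambda>_. 0)"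
          by (simp_all add: 2(2) \<open>\<And>y. y \<notin> writes two_colour \<Longrightarrow> _ y\<close> zero)
        show "b = b'" if "s2 ''mate'' b \<noteq> 0" "s2 ''mate'' b = s2 ''mate'' b'" for b b'
          using mate_inj that .
        \<comment> \<open>Mates lie in \<open>A\<close>, while \<open>b\<close>, being adjacent to
          its mate, does not.\<close>
        show "b \<noteq> s2 ''mate'' b'" if "s2 ''mate'' b \<noteq> 0" "s2 ''mate'' b' \<noteq> 0" for b b'
          using mate_left that A[OF mate_edge[OF that(1)]] by metis
      qed
      then have "wp number_pairs (X * 100)
          (wp (emit (Var ''k'') ;; emit_vars ''idx'' ;; emit_vars ''pt'')
            (20 + (X * 100 + X * 100)) ?Q) s2"
      proof (rule wp_conseq, goal_cases)
        case (2 s3)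
        have inp3: "reads_graph s3" by (rule reads_graph_cong[OF _ _ _ _ inp2]) (use 2(2) in simp_all)
        have "s3 ''outlen'' 0 = 0"
          by (simp add: 2(2) \<open>\<And>y. y \<notin> writes run_auction \<Longrightarrow> _ y\<close>
              \<open>\<And>y. y \<notin> writes two_colour \<Longrightarrow> _ y\<close> zero)
        from wp_emit_pairing[OF inp3 this] show ?case
          by (rule wp_mono) (use numbered_pairing[OF 2(1) mate_edge] M S in
              \<open>unfold optimal_output_def, metis\<close>)
      qed simp
      then show ?case by (rule wp_Seq) simp
    qed simp
    then show ?case by (rule wp_Seq) simp
  qed simp
qed simp

lemma runs_matching_code_program:
  assumes "bipartite G"
  obtains t s k idx pt M S where
    "runs matching_code_program (input_state q G es) t s" "t \<le> program_time"
    "outputs s (desc_tokens G (pairing_code k idx pt))" "pairing G k idx pt"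
    "matching G M" "card M = k" "vertex_cover G S" "card S = k"
  using wp_matching_code_program[OF assms, of q] unfolding wp_def optimal_output_def by blast

lemma CAP_pairing_code:
  assumes F: "is_Fq q F" and pairing: "pairing G k idx pt" and S: "vertex_cover G S" "card S = k"
  shows "CAP F G = real k"
  using CAP_eqI[OF F _ pairing_code_nonempty[OF F pairing] S(1)] code_dim_pairing_code[OF F pairing]
    describes_pairing_code[OF F pairing] S(2)
  by (simp add: describes_rdss_code_def)

end

text \<open>The capacity formula mentions no edge list, but its matching and cover come from a run
  of the program, which needs one as input.\<close>

lemma obtain_edge_list:
  assumes "simple_graph G"
  obtains es where "edge_list G es"
proof -
  have "\<exists>u v. e = {u, v}" if "e \<in> edges G" for e
    using assms that unfolding simple_graph_def by (metis card_2_iff)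
  then obtain u v where uv: "\<And>e. e \<in> edges G \<Longrightarrow> e = {u e, v e}" by metis
  obtain ds where ds: "set ds = edges G" "distinct ds"
    using finite_distinct_list[OF finite_edges[OF assms]] by blast
  have "map (\<lambda>(u, v). {u, v}) (map (\<lambda>e. (u e, v e)) ds) = ds"
    using uv ds(1) by (auto intro!: map_idI)
  then show ?thesis using ds that[of "map (\<lambda>e. (u e, v e)) ds"] by (simp add: edge_list_def)
qed

theorem mainTheorem9:
  shows "(\<forall>(G :: ugraph) (q :: nat) (F :: 'f ring).
            simple_graph G \<and> bipartite G \<and> primepow q \<and> is_Fq q F \<longrightarrow>
              CAP F G = real (matching_number G))
       \<and> (\<exists>(P :: com) (p :: nat poly).
            \<forall>(G :: ugraph) (q :: nat) (F :: 'f ring) (es :: (nat \<times> nat) list).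
              simple_graph G \<and> bipartite G \<and> primepow q \<and> is_Fq q F \<and> edge_list G es \<longrightarrow>
                (\<exists>t s D. runs P (input_state q G es) t s \<and>
                         t \<le> poly p (graph_size G) \<and>
                         outputs s (desc_tokens G D) \<and>
                         describes_rdss_code F G D \<and>
                         code_dim F (described_code F G D) = CAP F G))"
proof (rule conjI)
  show "\<forall>(G :: ugraph) (q :: nat) (F :: 'f ring).
      simple_graph G \<and> bipartite G \<and> primepow q \<and> is_Fq q F \<longrightarrow> CAP F G = real (matching_number G)"
  proof (intro allI impI, elim conjE)
    fix G :: ugraph and q :: nat and F :: "'f ring"
    assume G: "simple_graph G" "bipartite G" and F: "is_Fq q F"
    obtain es where "edge_list G es" using obtain_edge_list[OF G(1)] .
    then interpret graph_input G es using G(1) by unfold_locales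
    obtain t s k idx pt M S where
      "runs matching_code_program (input_state q G es) t s" "t \<le> program_time"
      "outputs s (desc_tokens G (pairing_code k idx pt))" "pairing G k idx pt"
      "matching G M" "card M = k" "vertex_cover G S" "card S = k"
      using runs_matching_code_program[OF G(2)] .
    then show "CAP F G = real (matching_number G)"
      using CAP_pairing_code[OF F] matching_number_eqI[OF G(1)] by metis
  qed
next
  \<comment> \<open>This is \<open>X\<close> as a polynomial in the graph size.\<close>
  let ?X = "[:2, 1:] :: nat poly"
  let ?p = "(?X * [:100:] + ?X * ([:200:] + ?X * [:100:])) +
    ([:20:] + ?X * ([:60:] + ?X * ?X * ([:100:] + ?X * [:100:])) +
       (?X * [:100:] + ([:20:] + (?X * [:100:] + ?X * [:100:]))))"
  show "\<exists>(P :: com) (p :: nat poly).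
      \<forall>(G :: ugraph) (q :: nat) (F :: 'f ring) (es :: (nat \<times> nat) list).
        simple_graph G \<and> bipartite G \<and> primepow q \<and> is_Fq q F \<and> edge_list G es \<longrightarrow>
          (\<exists>t s D. runs P (input_state q G es) t s \<and> t \<le> poly p (graph_size G) \<and>
             outputs s (desc_tokens G D) \<and> describes_rdss_code F G D \<and>
             code_dim F (described_code F G D) = CAP F G)"
  proof (rule exI[of _ matching_code_program], rule exI[of _ ?p], intro allI impI, elim conjE)
    fix G :: ugraph and q :: nat and F :: "'f ring" and es
    assume G: "simple_graph G" "bipartite G" and F: "is_Fq q F" and es: "edge_list G es"
    interpret graph_input G es using G(1) es by unfold_locales
    obtain t s k idx pt M S where *:
      "runs matching_code_program (input_state q G es) t s" "t \<le> program_time"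
      "outputs s (desc_tokens G (pairing_code k idx pt))" "pairing G k idx pt"
      "matching G M" "card M = k" "vertex_cover G S" "card S = k"
      using runs_matching_code_program[OF G(2)] .
    have "poly ?X (graph_size G) = X" by (simp add: X_def)
    then have "poly ?p (graph_size G) = program_time"
      unfolding program_time_def poly_add poly_mult by simp
    then show "\<exists>t s D. runs matching_code_program (input_state q G es) t s \<and>
        t \<le> poly ?p (graph_size G) \<and> outputs s (desc_tokens G D) \<and>
        describes_rdss_code F G D \<and> code_dim F (described_code F G D) = CAP F G"
      using * describes_pairing_code[OF F *(4)] code_dim_pairing_code[OF F *(4)]
        CAP_pairing_code[OF F *(4,7,8)] by metis
  qed
qed

end
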